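(* Let $d\ge 2$ be an integer. Then $$\mathrm{RT}^*(C^{(r)}_d)=\inf\{E^*(\mathbf u):\ \mathbf u \text{ is a recurrent rich sequence over a } d\text{-letter alphabet}\}=2.$$
   Context: For a non-empty finite word $u$ and a rational $e>0$ with $e|u|\in\mathbb N$, $u^e$ denotes the prefix of length $e|u|$ of the periodic sequence $uuu\cdots$. For a sequence $\mathbf u$, its critical exponent is $E(\mathbf u)=\sup\{e\in\mathbb Q: u^e \text{ is a factor of } \mathbf u \text{ for some non-empty word } u\}$. The asymptotic critical exponent $E^*(\mathbf u)$ is $+\infty$ if $E(\mathbf u)=+\infty$, and otherwise $E^*(\mathbf u)=\lim_{n\to\infty}\sup\{e\in\mathbb Q: u^e \text{ is a factor of } \mathbf u \text{ for some } u \text{ with } |u|\ge n\}$. A finite word of length $n$ is rich if it contains $n+1$ distinct palindromic factors (the empty word included); a sequence is rich if all its factors are rich. A sequence is recurrent if each of its factors occurs infinitely many times. *)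

theory Defs
  imports "HOL-Library.Sublist" "HOL-Library.Extended_Real"
begin

definition occurs_at :: "'a list \<Rightarrow> (nat \<Rightarrow> 'a) \<Rightarrow> nat \<Rightarrow> bool" where
  "occurs_at w u i \<longleftrightarrow> map u [i..<i + length w] = w"

definition factor_of :: "'a list \<Rightarrow> (nat \<Rightarrow> 'a) \<Rightarrow> bool" where
  "factor_of w u \<longleftrightarrow> (\<exists>i. occurs_at w u i)"

text \<open>The power of a word with rational exponent \<open>e\<close>. It is only meaningful under the guard
  \<open>valid_exponent\<close>, in which case the floor is exact.\<close>

definition valid_exponent :: "'a list \<Rightarrow> rat \<Rightarrow> bool" where
  "valid_exponent w e \<longleftrightarrow> w \<noteq> [] \<and> e > 0 \<and> e * of_nat (length w) \<in> \<nat>"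

definition word_power :: "'a list \<Rightarrow> rat \<Rightarrow> 'a list" where
  "word_power w e =
     map (\<lambda>i. w ! (i mod length w)) [0..<nat \<lfloor>e * of_nat (length w)\<rfloor>]"

definition exponents :: "(nat \<Rightarrow> 'a) \<Rightarrow> nat \<Rightarrow> rat set" where
  "exponents u n =
     {e. \<exists>w. valid_exponent w e \<and> length w \<ge> n \<and> factor_of (word_power w e) u}"

definition critical_exponent :: "(nat \<Rightarrow> 'a) \<Rightarrow> ereal" where
  "critical_exponent u = (SUP e\<in>exponents u 0. ereal (of_rat e))"

text \<open>The limit below always exists: the sets of exponents decrease in \<open>n\<close>, so the suprema
  form a decreasing sequence of extended reals.\<close>

definition asymptotic_critical_exponent :: "(nat \<Rightarrow> 'a) \<Rightarrow> ereal" where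
  "asymptotic_critical_exponent u =
     (if critical_exponent u = \<infinity> then \<infinity>
      else lim (\<lambda>n. SUP e\<in>exponents u n. ereal (of_rat e)))"

definition rich_word :: "'a list \<Rightarrow> bool" where
  "rich_word w \<longleftrightarrow> card {p. sublist p w \<and> rev p = p} = length w + 1"

definition rich :: "(nat \<Rightarrow> 'a) \<Rightarrow> bool" where
  "rich u \<longleftrightarrow> (\<forall>w. factor_of w u \<longrightarrow> rich_word w)"

definition recurrent :: "(nat \<Rightarrow> 'a) \<Rightarrow> bool" where
  "recurrent u \<longleftrightarrow> (\<forall>w. factor_of w u \<longrightarrow> infinite {i. occurs_at w u i})"

text \<open>A sequence over the alphabet \<open>A\<close> need not use every letter of \<open>A\<close>.\<close>

definition recurrent_rich_sequences :: "'a set \<Rightarrow> (nat \<Rightarrow> 'a) set" where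
  "recurrent_rich_sequences A = {u. range u \<subseteq> A \<and> recurrent u \<and> rich u}"

definition asymptotic_repetition_threshold :: "(nat \<Rightarrow> 'a) set \<Rightarrow> ereal" where
  "asymptotic_repetition_threshold C = (INF u\<in>C. asymptotic_critical_exponent u)"

end

theory Submission
  imports Defs
begin

text \<open>
  \<^emph>\<open>Lower bound.\<close> In a rich sequence every position ends a palindrome that has not occurred before,
  so over a finite alphabet these palindromes get arbitrarily long, and recurrence yields arbitrarily
  long palindromic prefixes. Reflecting one of the former palindromes in the middle of one of the
  latter gives a long factor of exponent at least 2.

  \<^emph>\<open>Upper bound.\<close> For a parameter \<open>m\<close> and a letter \<open>c\<close> let \<open>W c n = c\<^sup>n\<^sup>+\<^sup>1\<close> for \<open>n \<le> m\<close> and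
  \<open>W c (n + 1) = W c n W (\<not> c) (n - m) W c n\<close> for \<open>n \<ge> m\<close>. Two copies of \<open>W c n\<close> are separated by a
  marker that is longer the higher its rank, but always of the form \<open>W (\<not> c) i\<close>; the markers on the
  two sides of a copy have different ranks, one of them \<open>n - m\<close>, and words of different rank are told
  apart after a common prefix that is short compared with \<open>W c n\<close>. Hence a repetition cannot extend
  far beyond a square, and the exponents of long repetitions are at most \<open>2 + 9 / (m + 1)\<close>. All
  \<open>W c n\<close> are rich, because each arises from its predecessor by two palindromic closures.
\<close>

section \<open>Richness of finite words\<close>

text \<open>The recursion reconciles two demands. Richness is obtained by palindromic closures,
  which produce near-squares at every scale; the exponent bound needs repetitions to break soon
  after two periods. A separator that never changed would make the sequence periodic, so its rank
  has to grow with \<open>n\<close>. The lag \<open>m\<close> keeps it short, by the factor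
  \<open>Suc m\<close> of \<open>len_scale'\<close>, and the opposite letter keeps it recognisable:
  \<open>W c j\<close> does not occur in \<open>W (\<not> c) (j + m)\<close> and enters the next
  rank only as its centre. The 9 in the bound is not optimised: the cases of the run bound give
  \<open>9 * p\<close> and \<open>(m + 7) * p\<close>, both at most \<open>(m + 10) * p\<close>, and
  \<open>(m + 10) / (m + 1) = 1 + 9 / (m + 1)\<close>. Two letters serve every alphabet
  size.\<close>

definition occ :: "'a list \<Rightarrow> 'a list \<Rightarrow> nat \<Rightarrow> bool" where
  "occ w x i \<longleftrightarrow> i + length w \<le> length x \<and> (\<forall>k<length w. x ! (i + k) = w ! k)"

lemma occ_trans: "occ w x i \<Longrightarrow> occ x y j \<Longrightarrow> occ w y (j + i)"
  by (auto simp: occ_def add.assoc)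

lemma occ_middle: "occ x (a @ x @ b) (length a)"
  by (auto simp: occ_def nth_append)

lemma occ_left: "occ a (a @ b) 0"
  by (auto simp: occ_def nth_append)

lemma occ_right: "occ b (a @ b) (length a)"
  by (auto simp: occ_def nth_append)

lemma occ_appendD1: "occ (a @ b) x i \<Longrightarrow> occ a x i"
  using occ_trans[OF occ_left] by fastforce

lemma occ_appendD2: "occ (a @ b) x i \<Longrightarrow> occ b x (i + length a)"
  using occ_trans[OF occ_right] by fastforce

lemma occ_drop_context:
  assumes "occ w (a @ x @ b) i" "length a \<le> i" "i + length w \<le> length a + length x"
  shows "occ w x (i - length a)"
proof -
  have "x ! (i - length a + k) = w ! k" if "k < length w" for k
  proof -
    have "(a @ x @ b) ! (i + k) = x ! (i + k - length a)"
    proof -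
      have "i + k - length a < length x" using that assms(2,3) by linarith
      then show ?thesis using assms(2) by (simp add: nth_append)
    qed
    moreover have "(a @ x @ b) ! (i + k) = w ! k"
      using assms(1) that by (auto simp: occ_def)
    ultimately show ?thesis using assms(2) by simp
  qed
  then show ?thesis using assms by (auto simp: occ_def)
qed

lemma occ_rev:
  assumes "occ w x i"
  shows "occ (rev w) (rev x) (length x - length w - i)"
proof -
  have "rev x ! (length x - length w - i + k) = rev w ! k" if k: "k < length w" for k
  proof -
    have le: "i + length w \<le> length x" using assms by (auto simp: occ_def)
    have "rev x ! (length x - length w - i + k) = x ! (i + (length w - Suc k))"
      using k le by (subst rev_nth) (auto intro!: arg_cong[of _ _ "nth x"])
    also have "\<dots> = w ! (length w - Suc k)"
      using assms k unfolding occ_def by (metis diff_Suc_less gr_implies_not0 not_gr_zero)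
    finally show ?thesis using k by (simp add: rev_nth)
  qed
  then show ?thesis using assms by (auto simp: occ_def)
qed

lemma sublist_iff_occ: "sublist w x \<longleftrightarrow> (\<exists>i. occ w x i)"
proof
  assume "sublist w x"
  then show "\<exists>i. occ w x i" by (auto simp: sublist_def intro: occ_middle)
next
  assume "\<exists>i. occ w x i"
  then obtain i where i: "occ w x i" by blast
  have "take (length w) (drop i x) = w"
    using i by (intro nth_equalityI) (auto simp: occ_def)
  then have "x = take i x @ w @ drop (length w) (drop i x)"
    by (metis append_take_drop_id)
  then show "sublist w x" by (metis sublist_appendI)
qed

section \<open>Counting palindromic factors letter by letter\<close>

definition pals :: "'a list \<Rightarrow> 'a list set" where
  "pals w = {p. sublist p w \<and> rev p = p}"

lemma rich_word_iff: "rich_word w \<longleftrightarrow> card (pals w) = length w + 1"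
  by (simp add: rich_word_def pals_def)

lemma finite_pals [simp]: "finite (pals w)"
  by (rule finite_subset[of _ "set (sublists w)"]) (auto simp: pals_def)

lemma pals_snoc_mono: "pals w \<subseteq> pals (w @ [a])"
  by (auto simp: pals_def sublist_append)

lemma new_pal_is_suffix: "p \<in> pals (w @ [a]) \<Longrightarrow> p \<notin> pals w \<Longrightarrow> suffix p (w @ [a])"
  by (auto simp: pals_def sublist_snoc)

text \<open>A palindromic suffix \<open>p\<close> of the palindrome \<open>q\<close> is also a
  prefix of \<open>q\<close>, so it occurs once more before the last letter. This is why a letter
  adds at most one palindrome, the longest palindromic suffix.\<close>

lemma shorter_pal_suffix_occurs:
  assumes "suffix p (w @ [a])" "suffix q (w @ [a])" "rev p = p" "rev q = q" "length p < length q"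
  shows "sublist p w"
proof -
  have "suffix p q" using assms(1,2,5) suffix_length_suffix by (metis less_imp_le)
  then have "prefix p q" using assms(3,4) by (simp add: suffix_to_prefix)
  then obtain r where r: "q = p @ r" "r \<noteq> []" using assms(5) by (auto simp: prefix_def)
  obtain z where "w @ [a] = z @ p @ r" using assms(2) r by (auto simp: suffix_def)
  then have "w = z @ p @ butlast r"
    using r(2) by (metis append_is_Nil_conv butlast_append butlast_snoc)
  then show ?thesis by auto
qed

lemma new_pal_unique:
  assumes p: "p \<in> pals (w @ [a])" "p \<notin> pals w" and s: "s \<in> pals (w @ [a])" "s \<notin> pals w"
  shows "p = s"
proof -
  have su: "suffix p (w @ [a])" "suffix s (w @ [a])"
    using new_pal_is_suffix[OF p] new_pal_is_suffix[OF s] by blast+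
  have pal: "rev p = p" "rev s = s" "\<not> sublist p w" "\<not> sublist s w"
    using p s unfolding pals_def by blast+
  have "length p = length s"
    using shorter_pal_suffix_occurs[OF su pal(1,2)]
      shorter_pal_suffix_occurs[OF su(2,1) pal(2,1)] pal(3,4) by (meson linorder_neqE_nat)
  then show ?thesis using su
    by (metis suffix_length_suffix suffix_order.antisym order_refl)
qed

lemma rich_word_snoc:
  assumes "rich_word w" "suffix s (w @ [a])" "rev s = s" "\<not> sublist s w"
  shows "rich_word (w @ [a])"
proof -
  have s: "s \<in> pals (w @ [a])" "s \<notin> pals w"
    using suffix_imp_sublist[OF assms(2)] assms(3,4) unfolding pals_def by blast+
  then have "insert s (pals w) \<subseteq> pals (w @ [a])" using pals_snoc_mono[of w a] by blast
  moreover have "pals (w @ [a]) \<subseteq> insert s (pals w)" using new_pal_unique[OF _ _ s] by blast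
  ultimately have "pals (w @ [a]) = insert s (pals w)" by (rule equalityI[rotated])
  then show ?thesis using assms(1) s(2) by (simp add: rich_word_iff)
qed

lemma rich_word_snocD:
  assumes "rich_word w" "rich_word (w @ [a])"
  obtains s where "suffix s (w @ [a])" "rev s = s" "\<not> sublist s w"
proof -
  have "pals (w @ [a]) \<noteq> pals w" using assms by (auto simp: rich_word_iff)
  then obtain s where s: "s \<in> pals (w @ [a])" "s \<notin> pals w" using pals_snoc_mono[of w a] by blast
  show thesis using that[OF new_pal_is_suffix[OF s]] s unfolding pals_def by blast
qed

lemma rich_word_Nil: "rich_word []"
proof -
  have "{p::'a list. p = [] \<and> rev p = p} = {[]}" by auto
  then show ?thesis by (simp add: rich_word_def)
qed

text \<open>Phrased for prefixes of one fixed word \<open>Z\<close>, so that a closure becomes an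
  induction on the length. A copy of the suffix inside \<open>take r Z\<close> would have to start
  before \<open>a\<close>, so excluding earlier starts is enough.\<close>

lemma rich_word_take_Suc:
  assumes "rich_word (take r Z)" "r < length Z" "a \<le> r"
    and pal: "rev (drop a (take (Suc r) Z)) = drop a (take (Suc r) Z)"
    and uni: "\<And>i. occ (drop a (take (Suc r) Z)) (take (Suc r) Z) i \<Longrightarrow> a \<le> i"
  shows "rich_word (take (Suc r) Z)"
proof -
  let ?s = "drop a (take (Suc r) Z)"
  have st: "take (Suc r) Z = take r Z @ [Z ! r]" using assms(2) by (rule take_Suc_conv_app_nth)
  have "\<not> sublist ?s (take r Z)"
  proof
    assume "sublist ?s (take r Z)"
    then obtain i where i: "occ ?s (take r Z) i" by (auto simp: sublist_iff_occ)
    then have "occ ?s (take (Suc r) Z) i"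
      using occ_trans[OF i occ_left[of "take r Z" "[Z ! r]"]] unfolding st by simp
    from uni[OF this] i show False using assms(2,3) by (auto simp: occ_def)
  qed
  moreover have "suffix ?s (take r Z @ [Z ! r])"
    unfolding st[symmetric] by (rule suffix_drop)
  ultimately have "rich_word (take r Z @ [Z ! r])"
    using rich_word_snoc[OF assms(1) _ pal] by blast
  then show ?thesis unfolding st .
qed

lemma rev_centre:
  assumes "rev Z = Z" "r \<le> length Z"
  shows "rev (drop (length Z - r) (take r Z)) = drop (length Z - r) (take r Z)"
proof -
  have "rev (drop (length Z - r) (take r Z)) = take (r - (length Z - r)) (rev (take r Z))"
    using assms(2) by (simp add: rev_drop)
  also have "\<dots> = take (r - (length Z - r)) (drop (length Z - r) Z)"
    using assms(1) by (simp only: rev_take)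
  finally show ?thesis by (simp only: drop_take)
qed

text \<open>Palindromic closure preserves richness: the longest palindromic suffix \<open>s\<close> of \<open>take r Z\<close>
  is the centre of \<open>Z\<close>, and the palindromic suffixes of the longer prefixes arise by extending \<open>s\<close>
  on both sides.\<close>

lemma rich_word_closure:
  assumes Z: "rev Z = Z" and r: "r \<le> length Z" "length Z < 2 * r" and rich: "rich_word (take r Z)"
    and uni: "\<And>i. occ (drop (length Z - r) (take r Z)) (take r Z) i \<Longrightarrow> length Z - r \<le> i"
  shows "r \<le> r' \<Longrightarrow> r' \<le> length Z \<Longrightarrow> rich_word (take r' Z)"
proof (induction r' rule: dec_induct)
  case base
  then show ?case using rich by simp
next
  case (step q)
  let ?n = "length Z"
  define s where "s = drop (?n - r) (take r Z)"
  have ls: "length s = 2 * r - ?n" using r by (simp add: s_def)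
  have s_nth: "s ! k = Z ! (?n - r + k)" if "k < length s" for k
    using that r by (simp add: s_def)
  \<comment> \<open>A copy starting no later than the centre lies inside \<open>take r Z\<close>,
    where \<open>uni\<close> applies.\<close>
  have uniZ: "?n - r \<le> i" if i: "occ s Z i" for i
  proof (cases "i \<le> ?n - r")
    case True
    have "occ s (take r Z) i"
      using i True ls r by (auto simp: occ_def)
    then show ?thesis using uni unfolding s_def by simp
  qed simp
  \<comment> \<open>\<open>d\<close> is how far the prefix reaches beyond \<open>r\<close>,
    \<open>e\<close> is the length of \<open>s\<close>, and \<open>f\<close> is the number of
    letters still missing at the end, which is also the start of the new suffix.\<close>
  obtain d where d: "Suc q = r + d" using le_Suc_ex[of r "Suc q"] step(1) by auto
  obtain e where e: "2 * r = ?n + e" using le_Suc_ex[of ?n "2 * r"] r(2) by auto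
  obtain f where f: "?n = Suc q + f" using le_Suc_ex[of "Suc q" ?n] step(4) by auto
  have nr: "?n - r = f + d" "?n - Suc q = f" using f d by linarith+
  show ?case
  proof (rule rich_word_take_Suc)
    let ?t = "drop (?n - Suc q) (take (Suc q) Z)"
    show "rich_word (take q Z)" using step by simp
    show "q < ?n" "?n - Suc q \<le> q" using step r by linarith+
    show "rev ?t = ?t" by (rule rev_centre[OF Z step(4)])
    fix i assume i: "occ ?t (take (Suc q) Z) i"
    have lq: "length (take (Suc q) Z) = Suc q" using step(4) by simp
    have lt: "length ?t = 2 * d + e" unfolding length_drop lq using d e f by linarith
    have ls': "length s = e" using ls e by linarith
    have il: "i + (2 * d + e) \<le> Suc q" using i unfolding occ_def lt lq by blast
    \<comment> \<open>The centre of \<open>?t\<close> is \<open>s\<close>, \<open>d\<close> letters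
      in from either end, so a copy of \<open>?t\<close> that is too early yields a copy of
      \<open>s\<close> that is too early.\<close>
    have "occ s Z (i + d)"
      unfolding occ_def ls'
    proof (intro conjI allI impI)
      show "i + d + e \<le> ?n" using il f by linarith
      fix k assume k: "k < e"
      then have kd: "d + k < 2 * d + e" by linarith
      then have eq: "take (Suc q) Z ! (i + (d + k)) = ?t ! (d + k)"
        using i unfolding occ_def lt by blast
      have 1: "i + (d + k) < Suc q" using kd il by linarith
      have 2: "f + (d + k) < Suc q" using k d e f by linarith
      have "?t ! (d + k) = take (Suc q) Z ! (f + (d + k))"
        unfolding nr(2) by (rule nth_drop) (use lq f d e in linarith)
      moreover have "s ! k = Z ! (f + d + k)" using s_nth[of k] k unfolding nr(1) ls' by blast
      ultimately show "Z ! (i + d + k) = s ! k"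
        using eq nth_take[OF 1, of Z] nth_take[OF 2, of Z] by (simp only: add.assoc)
    qed
    then have "f + d \<le> i + d" using uniZ unfolding nr(1) by blast
    then show "?n - Suc q \<le> i" unfolding nr(2) by linarith
  qed
qed

text \<open>Richness is known for the prefix of length \<open>r\<close>, but the centre is tested
  one letter later: in the applications that letter moves the centre of the longest palindromic
  suffix to the middle of \<open>Z\<close>, and only the new suffix has to be unique.\<close>

lemma rich_word_closure_Suc:
  assumes Z: "rev Z = Z" and r: "Suc r \<le> length Z" "length Z \<le> Suc (2 * r)"
    and rich: "rich_word (take r Z)"
    and uni: "\<And>i. occ (drop (length Z - Suc r) (take (Suc r) Z)) (take (Suc r) Z) i \<Longrightarrow> length Z - Suc r \<le> i"
    and r': "r \<le> r'" "r' \<le> length Z"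
  shows "rich_word (take r' Z)"
proof (cases "r' = r")
  case False
  have "rich_word (take (Suc r) Z)"
    by (rule rich_word_take_Suc[OF rich _ _ rev_centre[OF Z r(1)] uni]) (use r in simp_all)
  then show ?thesis
    using rich_word_closure[OF Z r(1) _ _ uni, of r'] r r' False by simp
qed (use rich in simp)

lemma rich_word_replicate: "rich_word (replicate k c)"
proof (induction k)
  case (Suc k)
  have eq: "replicate (Suc k) c = replicate k c @ [c]" by (simp add: replicate_append_same)
  have "\<not> sublist (replicate k c @ [c]) (replicate k c)"
    using sublist_length_le[of "replicate k c @ [c]" "replicate k c"] by auto
  then show ?case unfolding eq
    by (intro rich_word_snoc[OF Suc, of "replicate k c @ [c]"]) (simp_all add: replicate_append_same)
qed (simp add: rich_word_Nil)

section \<open>Richness of factors, reversals and letter-wise images\<close>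

lemma card_pals_snoc_le: "card (pals (w @ [a])) \<le> Suc (card (pals w))"
proof (cases "\<exists>s. s \<in> pals (w @ [a]) \<and> s \<notin> pals w")
  case True
  then obtain s where s: "s \<in> pals (w @ [a])" "s \<notin> pals w" by blast
  have "pals (w @ [a]) \<subseteq> insert s (pals w)" using new_pal_unique[OF _ _ s] by blast
  then have "card (pals (w @ [a])) \<le> card (insert s (pals w))" by (intro card_mono) simp_all
  then show ?thesis using s by simp
next
  case False
  then have "card (pals (w @ [a])) \<le> card (pals w)" by (intro card_mono) auto
  then show ?thesis by simp
qed

lemma card_pals_le:
  fixes w :: "'a list"
  shows "card (pals w) \<le> length w + 1"
proof (induction w rule: rev_induct)
  case Nil
  have "rich_word ([] :: 'a list)" by (rule rich_word_Nil)
  then show ?case by (simp add: rich_word_iff)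
next
  case (snoc a w)
  then show ?case using card_pals_snoc_le[of w a] by simp
qed

text \<open>The full count leaves no room for a letter that contributed no palindrome.\<close>

lemma rich_word_appendD: "rich_word (v @ w) \<Longrightarrow> rich_word v"
proof (induction w rule: rev_induct)
  case (snoc a w)
  have "card (pals ((v @ w) @ [a])) = Suc (length (v @ w)) + 1"
    using snoc.prems by (simp add: rich_word_iff)
  then have "rich_word (v @ w)"
    using card_pals_snoc_le[of "v @ w" a] card_pals_le[of "v @ w"] by (simp add: rich_word_iff)
  then show ?case by (rule snoc.IH)
qed simp

lemma rich_word_rev: "rich_word (rev w) \<longleftrightarrow> rich_word w"
proof -
  have "sublist p (rev w) \<longleftrightarrow> sublist p w" if "rev p = p" for p
    using that sublist_rev[of p w] by simp
  then have "pals (rev w) = pals w" unfolding pals_def by blast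
  then show ?thesis by (simp add: rich_word_iff)
qed

lemma rich_word_sublist:
  assumes "rich_word w" "sublist v w"
  shows "rich_word v"
proof -
  obtain a b where w: "w = a @ v @ b" using assms(2) by (auto simp: sublist_def)
  have "rich_word (a @ v)" using assms(1) w rich_word_appendD[of "a @ v" b] by simp
  then have "rich_word (rev v @ rev a)" using rich_word_rev[of "a @ v"] by simp
  then show ?thesis using rich_word_appendD rich_word_rev by blast
qed

lemma rich_word_map:
  assumes f: "inj f" and rich: "rich_word w"
  shows "rich_word (map f w)"
proof -
  have "pals (map f w) = map f ` pals w"
  proof (intro equalityI subsetI)
    fix p assume p: "p \<in> pals (map f w)"
    then obtain a b where "map f w = a @ p @ b" by (auto simp: pals_def sublist_def)
    then obtain a' p' b' where q: "w = a' @ p' @ b'" "p = map f p'"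
      by (auto simp: map_eq_append_conv append_eq_map_conv)
    have "map f (rev p') = map f p'" using p q by (auto simp: pals_def rev_map)
    then have "rev p' = p'" using f by (simp add: inj_map_eq_map)
    then show "p \<in> map f ` pals w" using q by (auto simp: pals_def)
  next
    fix p assume "p \<in> map f ` pals w"
    then show "p \<in> pals (map f w)" by (auto simp: pals_def rev_map map_mono_sublist)
  qed
  moreover have "inj_on (map f) (pals w)" using f by (simp add: inj_on_def inj_map_eq_map)
  ultimately show ?thesis using rich by (simp add: rich_word_iff card_image)
qed

section \<open>Rich recurrent sequences contain long squares\<close>

definition segment :: "(nat \<Rightarrow> 'a) \<Rightarrow> nat \<Rightarrow> nat \<Rightarrow> 'a list" where
  "segment u i j = map u [i..<j]"

lemma length_segment [simp]: "length (segment u i j) = j - i"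
  by (simp add: segment_def)

lemma nth_segment [simp]: "k < j - i \<Longrightarrow> segment u i j ! k = u (i + k)"
  by (simp add: segment_def)

lemma segment_append: "i \<le> j \<Longrightarrow> j \<le> k \<Longrightarrow> segment u i k = segment u i j @ segment u j k"
  unfolding segment_def by (metis le_Suc_ex map_append upt_add_eq_append)

lemma segment_Suc: "i \<le> j \<Longrightarrow> segment u i (Suc j) = segment u i j @ [u j]"
  by (simp add: segment_def)

lemma sublist_segment: "i' \<le> i \<Longrightarrow> j \<le> j' \<Longrightarrow> sublist (segment u i j) (segment u i' j')"
proof (cases "i \<le> j")
  case True
  assume *: "i' \<le> i" "j \<le> j'"
  then have "segment u i' j' = segment u i' i @ segment u i j @ segment u j j'"
    using True segment_append[of i' i j' u] segment_append[of i j j' u] by simp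
  then show ?thesis by (metis sublist_appendI)
qed (simp add: segment_def)

lemma factor_of_segment: "i \<le> j \<Longrightarrow> factor_of (segment u i j) u"
  unfolding factor_of_def occurs_at_def segment_def by (rule exI[of _ i]) simp

lemma factor_of_segmentE:
  assumes "factor_of w u"
  obtains i where "w = segment u i (i + length w)"
  using assms unfolding factor_of_def occurs_at_def segment_def by metis

lemma rev_segment_nth:
  assumes "rev (segment u i j) = segment u i j" "i \<le> k" "k < j"
  shows "u k = u (i + j - Suc k)"
proof -
  have "segment u i j ! (k - i) = rev (segment u i j) ! (k - i)" using assms(1) by simp
  also have "\<dots> = segment u i j ! (j - i - Suc (k - i))"
    using assms(2,3) by (subst rev_nth) auto
  finally show ?thesis using assms(2,3) by simp
qed

lemma rich_new_palindrome:
  assumes "rich u"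
  shows "\<exists>a\<le>n. rev (segment u a (Suc n)) = segment u a (Suc n) \<and>
           \<not> sublist (segment u a (Suc n)) (segment u 0 n)"
proof -
  have "rich_word (segment u 0 k)" for k
    using assms factor_of_segment[of 0 k u] by (simp add: rich_def)
  then obtain s where s: "suffix s (segment u 0 (Suc n))" "rev s = s" "\<not> sublist s (segment u 0 n)"
    using rich_word_snocD[of "segment u 0 n" "u n"] by (metis segment_Suc zero_le)
  have "length s \<le> Suc n" using suffix_length_le[OF s(1)] by simp
  then have "segment u 0 (Suc n) = segment u 0 (Suc n - length s) @ segment u (Suc n - length s) (Suc n)"
    by (intro segment_append) auto
  then have eq: "s = segment u (Suc n - length s) (Suc n)"
    using s(1) \<open>length s \<le> Suc n\<close>
    by (metis (no_types, lifting) append_eq_append_conv diff_diff_cancel length_segment suffix_def)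
  have "s \<noteq> []" using s(3) by auto
  then have "Suc n - length s \<le> n" by (cases s) auto
  then show ?thesis using s eq by metis
qed

text \<open>Each palindrome is new where it ends, so different positions have different ones, and
  there are only finitely many short words over \<open>A\<close>.\<close>

lemma finite_short_palindromes:
  assumes A: "finite A" "range u \<subseteq> A"
    and new: "\<And>n. \<not> sublist (segment u (a n) (Suc n)) (segment u 0 n)"
  shows "finite {n. Suc n - a n \<le> K}"
proof (rule finite_imageD)
  show "finite ((\<lambda>n. segment u (a n) (Suc n)) ` {n. Suc n - a n \<le> K})"
    by (rule finite_subset[OF _ finite_lists_length_le[OF A(1), of K]])
       (auto simp: segment_def intro: range_subsetD[OF A(2)])
  show "inj_on (\<lambda>n. segment u (a n) (Suc n)) {n. Suc n - a n \<le> K}"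
  proof (rule inj_onI, rule ccontr)
    fix n n' assume eq: "segment u (a n) (Suc n) = segment u (a n') (Suc n')" and "n \<noteq> n'"
    then consider "n < n'" | "n' < n" by linarith
    then show False
    proof cases
      case 1
      then show False using new[of n'] sublist_segment[of 0 "a n" "Suc n" n' u] eq by simp
    next
      case 2
      then show False using new[of n] sublist_segment[of 0 "a n'" "Suc n'" n u] eq by simp
    qed
  qed
qed

text \<open>Take the first later position at which the prefix \<open>P\<close> of length \<open>N\<close> or its reversal ends.
  The new palindrome ending there is longer than \<open>P\<close>, so it starts with \<open>P\<close> or its reversal, hence
  at position 0.\<close>

lemma arbitrarily_long_palindromic_prefixes:
  assumes rich: "rich u" and rec: "recurrent u"
  shows "\<exists>M>N. rev (segment u 0 M) = segment u 0 M"
proof -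
  let ?P = "segment u 0 N"
  define good where "good m \<longleftrightarrow> N < m \<and> (segment u (m - N) m = ?P \<or> segment u (m - N) m = rev ?P)" for m
  have "infinite {i. occurs_at ?P u i}"
    using rec factor_of_segment[of 0 N u] by (simp add: recurrent_def)
  then have "\<not> {i. occurs_at ?P u i} \<subseteq> {0}" using infinite_super by blast
  then obtain i where "occurs_at ?P u i" "0 < i" by auto
  then have "good (i + N)" by (simp add: good_def occurs_at_def segment_def)
  define m where "m = (LEAST m. good m)"
  have gm: "good m" unfolding m_def by (rule LeastI) fact
  have least: "\<not> good m'" if "m' < m" for m' using not_less_Least that unfolding m_def .
  obtain n where n: "m = Suc n" "N \<le> n" using gm by (cases m) (auto simp: good_def)
  obtain a where a: "a \<le> n" "rev (segment u a m) = segment u a m"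
    "\<not> sublist (segment u a m) (segment u 0 n)"
    using rich_new_palindrome[OF rich, of n] n by blast
  \<comment> \<open>Otherwise the palindrome is a suffix of \<open>?P\<close> or of its reversal,
    hence a factor of \<open>?P\<close>, and is not new.\<close>
  have "a + N < m"
  proof (rule ccontr)
    assume "\<not> a + N < m"
    then have "segment u (m - N) m = segment u (m - N) a @ segment u a m"
      using a n by (intro segment_append) auto
    then have "suffix (segment u a m) ?P \<or> suffix (segment u a m) (rev ?P)"
      using gm unfolding good_def suffix_def by metis
    then have "sublist (segment u a m) ?P"
      using a(2) by (metis suffix_imp_sublist prefix_imp_sublist suffix_to_prefix rev_rev_ident)
    moreover have "sublist ?P (segment u 0 n)" using n by (intro sublist_segment) auto
    ultimately show False using a(3) sublist_order.order_trans by blast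
  qed
  have "segment u a (a + N) = rev (segment u (m - N) m)"
  proof (rule nth_equalityI)
    fix k assume "k < length (segment u a (a + N))"
    then have k: "k < N" by simp
    have "rev (segment u (m - N) m) ! k = u (m - Suc k)"
      using k \<open>a + N < m\<close> by (subst rev_nth) auto
    moreover have "u (a + k) = u (a + m - Suc (a + k))"
      using rev_segment_nth[OF a(2), of "a + k"] k \<open>a + N < m\<close> by simp
    ultimately show "segment u a (a + N) ! k = rev (segment u (m - N) m) ! k" using k by simp
  qed (use \<open>a + N < m\<close> in simp)
  then have "segment u a (a + N) = ?P \<or> segment u a (a + N) = rev ?P"
    using gm by (auto simp: good_def)
  then have "\<not> 0 < a" using least[OF \<open>a + N < m\<close>] by (auto simp: good_def)
  then show ?thesis using a gm by (auto simp: good_def)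
qed

text \<open>Let \<open>M\<close> be the length of a palindromic prefix and \<open>n\<close> the last position whose new palindrome
  is centred before the middle of that prefix. Reflecting this palindrome in the middle yields a copy
  of it that overlaps or touches it.\<close>

lemma rich_long_squares:
  assumes rich: "rich u" and rec: "recurrent u" and A: "finite A" "range u \<subseteq> A"
  shows "\<exists>i r L. 1 \<le> r \<and> r \<le> L \<and> K \<le> L \<and> (\<forall>k<L. u (i + k) = u (i + r + k))"
proof -
  have "\<forall>n. \<exists>a\<le>n. rev (segment u a (Suc n)) = segment u a (Suc n) \<and>
           \<not> sublist (segment u a (Suc n)) (segment u 0 n)"
    using rich_new_palindrome[OF rich] by blast
  then obtain a where a: "\<And>n. a n \<le> n" "\<And>n. rev (segment u (a n) (Suc n)) = segment u (a n) (Suc n)"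
    "\<And>n. \<not> sublist (segment u (a n) (Suc n)) (segment u 0 n)" by metis
  have "finite {n. Suc n - a n \<le> Suc K}" by (rule finite_short_palindromes[OF A a(3)])
  then obtain n0 where n0: "\<And>n. Suc n - a n \<le> Suc K \<Longrightarrow> n < n0"
    unfolding finite_nat_set_iff_bounded by blast
  \<comment> \<open>Large enough that the two consecutive palindromes around the crossing of the
    middle both end after \<open>n0\<close> and are therefore long.\<close>
  obtain M where M: "2 * n0 + 4 < M" "rev (segment u 0 M) = segment u 0 M"
    using arbitrarily_long_palindromic_prefixes[OF rich rec] by blast
  \<comment> \<open>Here \<open>n\<close> counts letters: for \<open>n > 0\<close> the palindrome
    covers the positions from \<open>a (n - 1)\<close> up to but excluding \<open>n\<close>, and the
    inequality puts its centre left of the middle. The value 0 for \<open>n = 0\<close> makes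
    \<open>S\<close> non-empty.\<close>
  define S where "S = {n. n \<le> M \<and> (case n of 0 \<Rightarrow> 0 | Suc n \<Rightarrow> a n) + n < M}"
  have fin: "finite S" unfolding S_def by simp
  have "0 \<in> S" using M by (simp add: S_def)
  then have "Max S \<in> S" using fin Max_in by blast
  moreover have "Suc (Max S) \<notin> S" using fin Max_ge by (metis Suc_n_not_le_n)
  moreover have "Max S \<noteq> M" using \<open>Max S \<in> S\<close> by (auto simp: S_def)
  ultimately have n: "Max S < M" "M \<le> a (Max S) + Suc (Max S)"
    unfolding S_def by auto
  have "a (Max S) \<le> Max S" by (rule a(1))
  then have big: "n0 + 1 < Max S" using n M by linarith
  then obtain j where j: "Max S = Suc j" "n0 < j" by (cases "Max S") auto
  have "\<not> Suc (Max S) - a (Max S) \<le> Suc K" using n0[of "Max S"] big by auto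
  \<comment> \<open>The next palindrome is not a single letter. As its centre is not left of the
    middle, \<open>Suc j\<close> is at least half of \<open>M\<close>, so the reflected copy leaves
    no gap.\<close>
  then have "a (Suc j) \<le> j" unfolding j(1) by simp
  then have M2: "M \<le> Suc j + Suc j" using n(2) unfolding j(1) by linarith
  have Lj: "\<not> Suc j - a j \<le> Suc K" using n0[of j] j by auto
  have aj: "a j + Suc j < M" using \<open>Max S \<in> S\<close> j by (simp add: S_def)
  show ?thesis
  proof (intro exI conjI allI impI)
    show "1 \<le> M - Suc j - a j" using aj by linarith
    show "M - Suc j - a j \<le> Suc j - a j" using M2 by linarith
    show "K \<le> Suc j - a j" using Lj by linarith
    \<comment> \<open>Reflection in the new palindrome followed by reflection in the prefix is the
      translation by \<open>M - Suc j - a j\<close>.\<close>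
    fix k assume k: "k < Suc j - a j"
    have "u (a j + k) = u (a j + Suc j - Suc (a j + k))"
      by (rule rev_segment_nth[OF a(2)]) (use k in linarith)+
    also have "a j + Suc j - Suc (a j + k) = j - k" by simp
    also have "u (j - k) = u (0 + M - Suc (j - k))"
      by (rule rev_segment_nth[OF M(2)]) (use n j in linarith)+
    also have "0 + M - Suc (j - k) = a j + (M - Suc j - a j) + k" using k aj by linarith
    finally show "u (a j + k) = u (a j + (M - Suc j - a j) + k)" .
  qed
qed

section \<open>Exponents expressed by periods\<close>

lemma exponentsI:
  fixes u :: "nat \<Rightarrow> 'a"
  assumes r: "1 \<le> r" "N \<le> r" and per: "\<And>k. k < L \<Longrightarrow> u (i + k) = u (i + r + k)"
  shows "of_nat (L + r) / of_nat r \<in> exponents u N"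
proof -
  let ?w = "segment u i (i + r)" and ?e = "of_nat (L + r) / of_nat r :: rat"
  have er: "?e * of_nat (length ?w) = of_nat (L + r)" using r by simp
  have mod: "u (i + j) = u (i + j mod r)" if "j < L + r" for j
    using that
  proof (induction j rule: less_induct)
    case (less j)
    show ?case
    proof (cases "j < r")
      case False
      then have "u (i + j) = u (i + (j - r))" using per[of "j - r"] less.prems by simp
      also have "\<dots> = u (i + (j - r) mod r)" by (rule less.IH) (use less.prems False r in linarith)+
      finally show ?thesis using False by (simp add: le_mod_geq)
    qed simp
  qed
  have "word_power ?w ?e = map (\<lambda>j. ?w ! (j mod length ?w)) [0..<L + r]"
    unfolding word_power_def er floor_of_nat by (simp only: nat_int)
  also have "\<dots> = segment u i (i + (L + r))"
    by (rule nth_equalityI) (use r mod in \<open>auto\<close>)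
  finally have "factor_of (word_power ?w ?e) u" using factor_of_segment[of i "i + (L + r)" u] by simp
  moreover have "valid_exponent ?w ?e"
    unfolding valid_exponent_def er using r
    by (auto simp: segment_def simp del: of_nat_add)
  ultimately show ?thesis unfolding exponents_def using r by (intro CollectI exI[of _ ?w]) simp
qed

lemma exponentsE:
  fixes u :: "nat \<Rightarrow> 'a"
  assumes "e \<in> exponents u n"
  obtains p L i where "1 \<le> p" "n \<le> p" "e = of_nat L / of_nat p"
    "\<And>k. k + p < L \<Longrightarrow> u (i + k) = u (i + k + p)"
proof -
  obtain w where w: "valid_exponent w e" "n \<le> length w" "factor_of (word_power w e) u"
    using assms unfolding exponents_def by blast
  obtain L where L: "e * of_nat (length w) = of_nat L"
    using w(1) unfolding valid_exponent_def by (auto elim: Nats_cases)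
  have p: "1 \<le> length w" using w(1) unfolding valid_exponent_def by (cases w) auto
  have wp: "word_power w e = map (\<lambda>j. w ! (j mod length w)) [0..<L]"
    unfolding word_power_def L by simp
  obtain i where i: "occurs_at (word_power w e) u i" using w(3) unfolding factor_of_def by blast
  then have eq: "map u [i..<i + L] = word_power w e" unfolding occurs_at_def wp by simp
  have nth: "u (i + k) = w ! (k mod length w)" if "k < L" for k
    using arg_cong[OF eq, of "\<lambda>x. x ! k"] that unfolding wp by simp
  show thesis
  proof (rule that[OF p w(2)])
    have "rat_of_nat (length w) \<noteq> 0" using p by auto
    then show "e = of_nat L / of_nat (length w)" using L by (simp add: eq_divide_eq)
    fix k assume "k + length w < L"
    then show "u (i + k) = u (i + k + length w)"
      using nth[of k] nth[of "k + length w"] by (simp add: add.assoc)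
  qed
qed

abbreviation exponent_sup :: "(nat \<Rightarrow> 'a) \<Rightarrow> nat \<Rightarrow> ereal" where
  "exponent_sup u n \<equiv> (SUP e\<in>exponents u n. ereal (of_rat e))"

lemma lim_exponent_sup: "lim (exponent_sup u) = (INF n. exponent_sup u n)"
proof (rule limI, rule LIMSEQ_INF, unfold decseq_def, intro allI impI)
  fix m n :: nat assume "m \<le> n"
  then have "exponents u n \<subseteq> exponents u m" unfolding exponents_def by auto
  then show "exponent_sup u n \<le> exponent_sup u m" by (rule SUP_subset_mono) simp
qed

text \<open>Long squares need not have long periods. If the periods stay below some
  \<open>N\<close>, arbitrarily long repetitions make the critical exponent infinite, and then so is
  the asymptotic one by definition.\<close>

lemma rich_asymptotic_lower_bound:
  assumes "rich u" "recurrent u" "finite A" "range u \<subseteq> A"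
  shows "2 \<le> asymptotic_critical_exponent u"
proof (cases "critical_exponent u = \<infinity>")
  case False
  have "2 \<le> exponent_sup u N" for N
  proof (rule ccontr)
    assume neg: "\<not> 2 \<le> exponent_sup u N"
    have bound: "ereal (real K) \<le> critical_exponent u" for K
    proof -
      \<comment> \<open>With length \<open>Suc K * Suc N\<close>, a period below \<open>N\<close>
        yields an exponent of at least \<open>K\<close>.\<close>
      obtain i r L where *: "1 \<le> r" "r \<le> L" "Suc K * Suc N \<le> L" "\<forall>k<L. u (i + k) = u (i + r + k)"
        using rich_long_squares[OF assms] by blast
      let ?e = "of_nat (L + r) / of_nat r :: rat"
      have re: "real_of_rat ?e = real (L + r) / real r" by (simp add: of_rat_divide of_rat_add)
      have "r < N"
      proof (rule ccontr)
        assume "\<not> r < N"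
        then have "?e \<in> exponents u N" using exponentsI[of r N L u i] * by auto
        moreover have "2 \<le> real_of_rat ?e" unfolding re using * by (simp add: field_simps)
        ultimately have "ereal 2 \<le> exponent_sup u N" by (intro SUP_upper2[of ?e]) simp_all
        then show False using neg by simp
      qed
      have e0: "?e \<in> exponents u 0" using exponentsI[of r 0 L u i] * by auto
      have "K * r \<le> Suc K * Suc N" using \<open>r < N\<close> by (intro mult_le_mono) auto
      then have "K * r \<le> L + r" using *(3) by linarith
      then have "real K * real r \<le> real (L + r)" by (metis of_nat_le_iff of_nat_mult)
      then have "real K \<le> real_of_rat ?e" unfolding re using * by (simp add: pos_le_divide_eq)
      then show ?thesis unfolding critical_exponent_def using e0 by (intro SUP_upper2[OF e0]) simp
    qed
    have "critical_exponent u = \<infinity>"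
    proof (rule ereal_top)
      fix B obtain K where "B \<le> real K" using real_arch_simple by blast
      then show "ereal B \<le> critical_exponent u" using bound[of K] order_trans ereal_less_eq(3) by blast
    qed
    then show False using False by simp
  qed
  then show ?thesis using False
    by (simp add: asymptotic_critical_exponent_def lim_exponent_sup le_INF_iff)
qed (simp add: asymptotic_critical_exponent_def)

section \<open>Marker words\<close>

text \<open>The powers up to rank \<open>m\<close> ensure that the truncated difference
  \<open>n - 1 - m\<close> is formed only where it is exact.\<close>

fun mword :: "nat \<Rightarrow> bool \<Rightarrow> nat \<Rightarrow> bool list" where
  "mword m c n =
    (if n \<le> m then replicate (Suc n) c
     else mword m c (n - 1) @ mword m (\<not> c) (n - 1 - m) @ mword m c (n - 1))"

declare mword.simps [simp del]

locale marker_words =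
  fixes m :: nat
  assumes m_pos: "1 \<le> m"
begin

abbreviation W :: "bool \<Rightarrow> nat \<Rightarrow> bool list" where "W \<equiv> mword m"

definition len :: "nat \<Rightarrow> nat" where "len n = length (W True n)"

text \<open>The limit of the words \<open>W c n\<close>: they extend each other, and
  \<open>k < len k\<close> makes position \<open>k\<close> available in
  \<open>W c k\<close>.\<close>

definition Winf :: "bool \<Rightarrow> nat \<Rightarrow> bool" where "Winf c k = W c k ! k"

lemma W_base: "n \<le> m \<Longrightarrow> W c n = replicate (Suc n) c"
  by (subst mword.simps) simp

lemma W_step: "m \<le> n \<Longrightarrow> W c (Suc n) = W c n @ W (\<not> c) (n - m) @ W c n"
  by (subst mword.simps) simp

lemma length_W_neg: "length (W (\<not> c) n) = length (W c n)"
proof (induction n arbitrary: c rule: less_induct)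
  case (less n)
  show ?case
  proof (cases "n \<le> m")
    case False
    then obtain k where "n = Suc k" "m \<le> k" by (cases n) auto
    then show ?thesis using less[of k] less[of "k - m"] by (simp add: W_step)
  qed (simp add: W_base)
qed

lemma length_W [simp]: "length (W c n) = len n"
  using length_W_neg[of True n] by (cases c) (auto simp: len_def)

lemma len_base: "n \<le> m \<Longrightarrow> len n = Suc n"
  unfolding len_def by (simp only: W_base length_replicate)

lemma len_step: "m \<le> n \<Longrightarrow> len (Suc n) = 2 * len n + len (n - m)"
proof -
  assume "m \<le> n"
  then have "length (W True (Suc n)) = length (W True n @ W (\<not> True) (n - m) @ W True n)"
    by (simp only: W_step)
  then show ?thesis by simp
qed

lemma len_pos [simp]: "0 < len n"
proof (induction n)
  case (Suc n)
  then show ?case by (cases "m \<le> n") (auto simp: len_base len_step)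
qed (simp add: len_base)

lemma len_less_Suc: "len n < len (Suc n)"
  using len_pos[of n] by (cases "m \<le> n") (auto simp: len_base len_step)

lemma strict_mono_len: "strict_mono len"
  by (simp add: strict_mono_Suc_iff len_less_Suc)

lemma len_less_iff [simp]: "len i < len j \<longleftrightarrow> i < j"
  by (rule strict_mono_less[OF strict_mono_len])

lemma len_le_iff [simp]: "len i \<le> len j \<longleftrightarrow> i \<le> j"
  by (rule strict_mono_less_eq[OF strict_mono_len])

lemma len_gt: "n < len n"
proof (induction n)
  case (Suc n)
  then show ?case using len_less_Suc[of n] by linarith
qed simp

lemma W_neg_nth: "k < len n \<Longrightarrow> W (\<not> c) n ! k = (\<not> W c n ! k)"
proof (induction n arbitrary: c k rule: less_induct)
  case (less n)
  show ?case
  proof (cases "n \<le> m")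
    case True
    then show ?thesis using less.prems by (simp add: W_base len_base del: replicate.simps)
  next
    case False
    then obtain j where j: "n = Suc j" "m \<le> j" by (cases n) auto
    have "k - len j < len (j - m)" if "k < len j + len (j - m)" "\<not> k < len j" using that by linarith
    moreover have "k - len j - len (j - m) < len j" if "\<not> k < len j + len (j - m)"
      using that less.prems j by (simp add: len_step)
    ultimately show ?thesis
      using less.prems j less.IH[of j k c] less.IH[of "j - m" "k - len j" "\<not> c"]
        less.IH[of j "k - len j - len (j - m)" c]
      by (auto simp: W_step nth_append)
  qed
qed

lemma rev_W [simp]: "rev (W c n) = W c n"
proof (induction n arbitrary: c rule: less_induct)
  case (less n)
  show ?case
  proof (cases "n \<le> m")
    case False
    then obtain k where "n = Suc k" "m \<le> k" by (cases n) auto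
    then show ?thesis using less[of k] less[of "k - m"] by (simp add: W_step)
  qed (simp add: W_base replicate_append_same del: replicate.simps)
qed

lemma prefix_W_Suc: "prefix (W c n) (W c (Suc n))"
proof (cases "m \<le> n")
  case False
  then have "W c (Suc n) = W c n @ [c]"
    by (simp add: W_base replicate_append_same[symmetric] del: replicate.simps)
       (simp add: replicate_append_same)
  then show ?thesis by simp
qed (simp add: W_step)

lemma prefix_W: "i \<le> j \<Longrightarrow> prefix (W c i) (W c j)"
  by (induction j rule: dec_induct) (auto intro: prefix_W_Suc prefix_order.trans)

lemma suffix_W: "i \<le> j \<Longrightarrow> suffix (W c i) (W c j)"
  using prefix_W[of i j c] by (simp add: suffix_to_prefix)

lemma W_nth: "k < len n \<Longrightarrow> W c n ! k = Winf c k"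
proof -
  assume k: "k < len n"
  have "W c i ! k = W c j ! k" if "i \<le> j" "k < len i" for i j
    using prefix_W[OF that(1), of c] that(2) by (auto simp: prefix_def nth_append)
  from this[of n k] this[of k n] show ?thesis
    using k len_gt[of k] unfolding Winf_def by (cases "n \<le> k") auto
qed

lemma W_nth_rev: "k < len n \<Longrightarrow> W c n ! (len n - Suc k) = Winf c k"
  using rev_nth[of k "W c n"] by (simp add: W_nth)

lemma Winf_neg: "Winf (\<not> c) k = (\<not> Winf c k)"
  unfolding Winf_def by (rule W_neg_nth) (rule len_gt)

lemma Winf_0 [simp]: "Winf c 0 = c"
  by (simp add: Winf_def W_base)

lemma Winf_step1:
  assumes "m \<le> n" "k < len (n - m)"
  shows "Winf c (len n + k) = Winf (\<not> c) k"
proof -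
  have "W c (Suc n) ! (len n + k) = W (\<not> c) (n - m) ! k"
    using assms by (simp add: W_step nth_append)
  then show ?thesis using assms by (simp add: W_nth len_step)
qed

lemma Winf_step2:
  assumes "m \<le> n" "k < len n"
  shows "Winf c (len n + len (n - m) + k) = Winf c k"
proof -
  have "W c (Suc n) ! (len n + len (n - m) + k) = W c n ! k"
    using assms by (simp add: W_step nth_append)
  then show ?thesis using assms by (simp add: W_nth len_step)
qed

lemma occ_W: "occ (W c j) x i \<longleftrightarrow> i + len j \<le> length x \<and> (\<forall>k<len j. x ! (i + k) = Winf c k)"
  by (auto simp: occ_def W_nth)

lemma occ_W_le: "occ (W c j) x i \<Longrightarrow> i' \<le> j \<Longrightarrow> occ (W c i') x i"
  using prefix_W[of i' j c] by (auto simp: prefix_def intro: occ_appendD1)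

lemma occ_W_le_right:
  assumes "occ (W c j) x i" "i' \<le> j"
  shows "occ (W c i') x (i + (len j - len i'))"
proof -
  obtain z where z: "W c j = z @ W c i'" using suffix_W[OF assms(2), of c] by (auto simp: suffix_def)
  have "len j = length z + len i'" using arg_cong[OF z, of length] by simp
  then show ?thesis using assms(1) unfolding z by (auto dest: occ_appendD2)
qed

lemma occ_W_rev: "occ (W c j) x i \<Longrightarrow> occ (W c j) (rev x) (length x - len j - i)"
  using occ_rev[of "W c j" x i] by simp

text \<open>The number \<open>len j + e\<close> below is the length of the longest common prefix of the limit
  words \<open>W c\<close> and \<open>W c j\<close> followed by \<open>W (\<not> c)\<close>; a marker of rank greater than \<open>j - m\<close>
  is already told apart from one of rank \<open>j - m\<close> by this prefix.\<close>

definition mismatch :: "nat \<Rightarrow> nat \<Rightarrow> bool" where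
  "mismatch j e \<longleftrightarrow> e < len (Suc j - m) \<and> len j + e < len (Suc j) \<and>
     (\<forall>c. (\<forall>k<e. Winf c (len j + k) = Winf (\<not> c) k) \<and> Winf c (len j + e) \<noteq> Winf (\<not> c) e)"

section \<open>Where the two limit words part\<close>

lemma mismatch_low: "j < m \<Longrightarrow> mismatch j 0"
proof -
  assume j: "j < m"
  then have "Winf c (len j) = c" for c
    using W_nth[of "len j" "Suc j" c]
    by (simp add: W_base len_base del: replicate.simps)
  then show ?thesis using j by (simp add: mismatch_def)
qed

text \<open>Here the marker after \<open>W c j\<close> is a power of \<open>\<not> c\<close>
  followed by \<open>c\<close>, while the limit word of \<open>\<not> c\<close> starts with a longer
  power; they part right after the marker.\<close>

lemma mismatch_mid:
  assumes "m \<le> j" "j < 2 * m"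
  shows "mismatch j (len (j - m))"
proof -
  have lt: "len (j - m) < len j" using assms m_pos by simp
  have "Winf c (len j + k) = Winf (\<not> c) k" if "k < len (j - m)" for c k
    using Winf_step1[OF assms(1) that] .
  moreover have "Winf c (len j + len (j - m)) = c" for c
    using Winf_step2[OF assms(1), of 0 c] by simp
  moreover have "Winf c (len (j - m)) = c" for c
    using mismatch_low[of "j - m"] assms unfolding mismatch_def
    by (metis Winf_0 Winf_neg add.right_neutral less_diff_conv2 mult_2)
  ultimately show ?thesis
    using lt assms by (simp add: mismatch_def Suc_diff_le len_step)
qed

text \<open>After \<open>W c j\<close> the limit word reads \<open>W (\<not> c) (j - m)\<close> and
  \<open>W c j\<close>; the limit word of \<open>\<not> c\<close> reads
  \<open>W (\<not> c) (j - m)\<close>, \<open>W c (j - 2 * m)\<close>,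
  \<open>W (\<not> c) (j - m)\<close>. Past the common marker this is the comparison for rank
  \<open>j - 2 * m\<close> with the sides exchanged.\<close>

lemma mismatch_step:
  assumes j: "2 * m \<le> j" and e: "mismatch (j - 2 * m) e"
  shows "mismatch j (len (j - m) + len (j - 2 * m) + e)"
proof -
  let ?a = "len (j - m)" and ?b = "len (j - 2 * m)"
  have jm: "m \<le> j" "m \<le> j - m" "j - m - m = j - 2 * m" using j by auto
  have "?b + e < len (Suc (j - 2 * m))" using e by (simp add: mismatch_def)
  also have "\<dots> \<le> ?a" using m_pos j by simp
  finally have be: "?b + e < ?a" .
  have al: "?a < len j" using m_pos j by simp
  have ee: "(\<And>c k. k < e \<Longrightarrow> Winf c (?b + k) = Winf (\<not> c) k)" "\<And>c. Winf c (?b + e) \<noteq> Winf (\<not> c) e"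
    using e by (auto simp: mismatch_def)
  have 1: "Winf c (len j + k) = Winf (\<not> c) k" if "k < ?a" for c k
    using Winf_step1[OF jm(1) that] .
  have 2: "Winf c (len j + ?a + k) = Winf c k" if "k < ?a" for c k
    using Winf_step2[OF jm(1) less_trans[OF that al]] .
  have 3: "Winf (\<not> c) (?a + k) = Winf c k" if "k < ?b" for c k
    using Winf_step1[OF jm(2), of k "\<not> c"] that jm(3) by simp
  have 4: "Winf (\<not> c) (?a + ?b + k) = Winf (\<not> c) k" if "k < ?a" for c k
    using Winf_step2[OF jm(2), of k "\<not> c"] that jm(3) by simp
  have agree: "Winf c (len j + k) = Winf (\<not> c) k" if k: "k < ?a + ?b + e" for c k
  proof -
    consider "k < ?a" | "?a \<le> k" "k < ?a + ?b" | "?a + ?b \<le> k" by linarith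
    then show ?thesis
    proof cases
      case 2
      then obtain h where h: "k = ?a + h" "h < ?b" by (metis le_Suc_ex nat_add_left_cancel_less)
      then show ?thesis using be 3[OF h(2)] \<open>\<And>k c. k < ?a \<Longrightarrow> Winf c (len j + ?a + k) = Winf c k\<close>[of h c]
        by (simp add: add.assoc)
    next
      case 3
      then obtain h where h: "k = ?a + ?b + h" "h < e"
        using k by (metis le_Suc_ex nat_add_left_cancel_less)
      then show ?thesis using be 4[of h c] 2[of "?b + h" c] ee(1)[of h c] by (simp add: add.assoc)
    qed (rule 1)
  qed
  moreover have "Winf c (len j + (?a + ?b + e)) \<noteq> Winf (\<not> c) (?a + ?b + e)" for c
    using be 4[of e c] 2[of "?b + e" c] ee(2)[of c] by (simp add: add.assoc)
  moreover have "?a + ?b + e < len (Suc j - m)" using be jm by (simp add: Suc_diff_le len_step)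
  moreover have "len j + (?a + ?b + e) < len (Suc j)"
    using less_trans[OF be al] jm by (simp add: len_step)
  ultimately show ?thesis unfolding mismatch_def by blast
qed

lemma mismatch_exists: "\<exists>e. mismatch j e"
proof (induction j rule: less_induct)
  case (less j)
  show ?case
  proof (cases "j < 2 * m")
    case False
    then obtain e where "mismatch (j - 2 * m) e" using less m_pos by fastforce
    then show ?thesis using mismatch_step False by (metis not_less)
  qed (use mismatch_low mismatch_mid in \<open>metis not_less\<close>)
qed

section \<open>Borders and overlaps of marker words\<close>

definition borders_ranked :: "nat \<Rightarrow> bool" where
  "borders_ranked j \<longleftrightarrow>
     (\<forall>c b. 0 < b \<and> b < len j \<and> (\<forall>k<b. Winf c (len j - b + k) = Winf c k) \<longrightarrow> (\<exists>i<j. b = len i))"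

text \<open>The overlap is a border, so it has the length of some \<open>W c i\<close>. Behind it
  the second copy continues as the limit word does after \<open>W c i\<close>, whereas the marker
  after the first copy starts like \<open>W (\<not> c)\<close>; \<open>mismatch i\<close> forbids
  this. \<open>borders_ranked\<close> is a hypothesis because its own induction uses this
  lemma.\<close>

lemma no_overlap_aux:
  assumes B: "borders_ranked j" and j: "m \<le> j"
    and 1: "occ (W c j) x r" and 2: "occ (W c j) x (r + p)" and p: "0 < p" "p < len j"
    and 3: "occ (W (\<not> c) (j - m)) x (r + len j)"
  shows False
proof -
  have x1: "x ! (r + k) = Winf c k" if "k < len j" for k using 1 that by (auto simp: occ_W)
  have x2: "x ! (r + (p + k)) = Winf c k" if "k < len j" for k
    using 2 that by (auto simp: occ_W add.assoc)
  have x3: "x ! (r + (len j + k)) = Winf (\<not> c) k" if "k < len (j - m)" for k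
    using 3 that by (auto simp: occ_W add.assoc)
  define b where "b = len j - p"
  have b: "0 < b" "b < len j" "len j - b = p" using p by (auto simp: b_def)
  have "Winf c (len j - b + k) = Winf c k" if "k < b" for k
    using x1[of "p + k"] x2[of k] that b by simp
  then obtain i where i: "i < j" "b = len i"
    using B b unfolding borders_ranked_def by blast
  obtain e where e: "mismatch i e" using mismatch_exists by blast
  have "Suc i - m \<le> j - m" using i by simp
  then have "len (Suc i - m) \<le> len (j - m)" by simp
  moreover have "e < len (Suc i - m)" using e by (simp add: mismatch_def)
  ultimately have e1: "e < len (j - m)" by linarith
  have "len (Suc i) \<le> len j" using i by simp
  moreover have "len i + e < len (Suc i)" using e by (simp add: mismatch_def)
  ultimately have e2: "len i + e < len j" by linarith
  have "p + (len i + e) = len j + e" using i(2) b by linarith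
  then have "Winf c (len i + e) = Winf (\<not> c) e" using x2[OF e2] x3[OF e1] by metis
  then show False using e by (auto simp: mismatch_def)
qed

lemma no_overlap_aux':
  assumes B: "borders_ranked j" and j: "m \<le> j"
    and 1: "occ (W c j) x r" and 2: "occ (W c j) x (r + p)" and p: "0 < p" "p < len j"
    and 3: "occ (W (\<not> c) (j - m)) x q" "q + len (j - m) = r + p"
  shows False
proof (rule no_overlap_aux[OF B j occ_W_rev[OF 2] _ p])
  have le: "r + p + len j \<le> length x" using 2 by (auto simp: occ_W)
  show "occ (W c j) (rev x) (length x - len j - (r + p) + p)"
    using occ_W_rev[OF 1] le by (simp add: algebra_simps)
  show "occ (W (\<not> c) (j - m)) (rev x) (length x - len j - (r + p) + len j)"
    using occ_W_rev[OF 3(1)] 3(2) le by (simp add: algebra_simps)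
qed

text \<open>The marker is shorter than \<open>W c j\<close>, so a copy elsewhere would properly
  overlap one of the end copies, both of which are adjacent to the marker.\<close>

lemma occ_Suc_ends_aux:
  assumes B: "borders_ranked j" and j: "m \<le> j" and r: "occ (W c j) (W c (Suc j)) r"
  shows "r = 0 \<or> r = len j + len (j - m)"
proof (rule ccontr)
  assume neg: "\<not> ?thesis"
  have rle: "r \<le> len j + len (j - m)" using r j by (auto simp: occ_W len_step)
  have o1: "occ (W c j) (W c (Suc j)) 0" by (rule occ_W_le[of c "Suc j"]) (auto simp: occ_def)
  have o2: "occ (W (\<not> c) (j - m)) (W c (Suc j)) (len j)"
    using occ_middle[of "W (\<not> c) (j - m)" "W c j" "W c j"] j by (simp add: W_step)
  have o3: "occ (W c j) (W c (Suc j)) (len j + len (j - m))"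
    using occ_right[of "W c j" "W c j @ W (\<not> c) (j - m)"] j by (simp add: W_step)
  have lt: "len (j - m) < len j" using j m_pos by simp
  show False
  proof (cases "r < len j")
    case True
    then show False using no_overlap_aux[OF B j o1 _ _ True] r o2 neg by simp
  next
    case False
    define p where "p = len j + len (j - m) - r"
    have "r \<noteq> len j + len (j - m)" using neg by simp
    then have p: "0 < p" "p < len j" "len j + len (j - m) = r + p"
      using rle False lt unfolding p_def by linarith+
    show False using no_overlap_aux'[OF B j r _ p(1,2) o2 p(3)] o3 unfolding p(3) .
  qed
qed

text \<open>A border of \<open>W c (Suc j)\<close> longer than \<open>W c j\<close> would put a copy
  of \<open>W c j\<close> strictly between the two end positions; one shorter than
  \<open>W c j\<close> is a border of \<open>W c j\<close>.\<close>

lemma borders_ranked_all: "borders_ranked j"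
proof (induction j)
  case 0
  then show ?case by (auto simp: borders_ranked_def len_base)
next
  case (Suc j)
  show ?case
  proof (cases "m \<le> j")
    case False
    have "\<exists>i<Suc j. b = len i" if "0 < b" "b < len (Suc j)" for b
      using that False by (intro exI[of _ "b - 1"]) (auto simp: len_base)
    then show ?thesis unfolding borders_ranked_def by blast
  next
    case j: True
    have "\<exists>i<Suc j. b = len i"
      if b: "0 < b" "b < len (Suc j)" and eq: "\<forall>k<b. Winf c (len (Suc j) - b + k) = Winf c k" for b c
    proof -
      consider "b < len j" | "b = len j" | "len j < b" by linarith
      then show ?thesis
      proof cases
        case 1
        have "Winf c (len j - b + k) = Winf c k" if "k < b" for k
        proof -
          have "Winf c (len j + len (j - m) + (len j - b + k)) = Winf c (len j - b + k)"
            by (rule Winf_step2[OF j]) (use that 1 in linarith)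
          moreover have "len j + len (j - m) + (len j - b + k) = len (Suc j) - b + k"
            using 1 j by (simp add: len_step)
          ultimately show ?thesis using eq that by simp
        qed
        then show ?thesis using Suc.IH 1 b unfolding borders_ranked_def by (meson less_SucI)
      next
        case 2
        then show ?thesis by blast
      next
        case 3
        have "W c (Suc j) ! (len (Suc j) - b + k) = Winf c k" if "k < len j" for k
          using eq that 3 b by (simp add: W_nth)
        then have "occ (W c j) (W c (Suc j)) (len (Suc j) - b)"
          using 3 b by (auto simp: occ_W)
        then have "len (Suc j) - b = 0 \<or> len (Suc j) - b = len j + len (j - m)"
          by (rule occ_Suc_ends_aux[OF Suc.IH j])
        then show ?thesis using 3 b j by (auto simp: len_step)
      qed
    qed
    then show ?thesis unfolding borders_ranked_def by blast
  qed
qed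

lemmas no_overlap = no_overlap_aux[OF borders_ranked_all]
lemmas occ_Suc_ends = occ_Suc_ends_aux[OF borders_ranked_all]

text \<open>A copy across the seam would properly overlap the \<open>W c j\<close> at the end of
  \<open>a\<close>, which is followed by a marker. Occurrences can therefore be located by splitting
  a word at its seams.\<close>

lemma no_straddle:
  assumes j: "m \<le> j" and r: "occ (W c j) (a @ b) r"
    and a: "suffix (W c j) a" and b: "prefix (W (\<not> c) (j - m)) b"
  shows "occ (W c j) a r \<or> length a \<le> r \<and> occ (W c j) b (r - length a)"
proof -
  obtain z where z: "a = z @ W c j" using a by (auto simp: suffix_def)
  obtain y where y: "b = W (\<not> c) (j - m) @ y" using b by (auto simp: prefix_def)
  have o1: "occ (W c j) (a @ b) (length z)"
    using occ_middle[of "W c j" z b] by (simp add: z)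
  have o2: "occ (W (\<not> c) (j - m)) (a @ b) (length z + len j)"
    using occ_middle[of "W (\<not> c) (j - m)" a y] by (simp add: y z)
  consider "r \<le> length z" | "length z < r" "r < length z + len j" | "length a \<le> r" using z by fastforce
  then show ?thesis
  proof cases
    case 1
    then show ?thesis using occ_drop_context[of "W c j" "[]" a b r] r by (simp add: z)
  next
    case 2
    then obtain p where "r = length z + p" "0 < p" "p < len j"
      by (metis less_imp_add_positive nat_add_left_cancel_less)
    then show ?thesis using no_overlap[OF j o1 _ _ _ o2, of p] r by auto
  next
    case 3
    then show ?thesis using occ_drop_context[of "W c j" a b "[]" r] r by (auto simp: occ_def)
  qed
qed

lemma no_straddle':
  assumes j: "m \<le> j" and r: "occ (W c j) (a @ b) r"
    and a: "suffix (W (\<not> c) (j - m)) a" and b: "prefix (W c j) b"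
  shows "occ (W c j) a r \<or> length a \<le> r \<and> occ (W c j) b (r - length a)"
proof -
  have le: "r + len j \<le> length a + length b" using r by (auto simp: occ_W)
  have "occ (W c j) (rev b @ rev a) (length a + length b - len j - r)"
    using occ_W_rev[OF r] by simp
  moreover have "suffix (W c j) (rev b)" "prefix (W (\<not> c) (j - m)) (rev a)"
    using a b by (simp_all add: suffix_to_prefix)
  ultimately consider "occ (W c j) (rev b) (length a + length b - len j - r)"
    | "length b \<le> length a + length b - len j - r"
      "occ (W c j) (rev a) (length a + length b - len j - r - length b)"
    using no_straddle[OF j, of c "rev b" "rev a"] by fastforce
  then show ?thesis
  proof cases
    case 1
    have "length a + length b - len j - r + len j \<le> length b" using 1 by (auto simp: occ_W)
    then have "length a \<le> r" "length b - len j - (length a + length b - len j - r) = r - length a"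
      using le by linarith+
    then show ?thesis using occ_W_rev[OF 1] by simp
  next
    case 2
    then show ?thesis using occ_W_rev[OF 2(2)] le by (simp add: algebra_simps)
  qed
qed

lemma occ_zone:
  assumes j: "m \<le> j" "j \<le> i" "j - m \<le> a"
    and r: "occ (W c j) (W c i @ W (\<not> c) a @ W c i) r"
  shows "occ (W c j) (W c i) r \<or> (len i \<le> r \<and> occ (W c j) (W (\<not> c) a) (r - len i)) \<or>
         (len i + len a \<le> r \<and> occ (W c j) (W c i) (r - (len i + len a)))"
proof -
  from no_straddle[OF j(1) r suffix_W[OF j(2)] prefix_prefix[OF prefix_W[OF j(3)]]]
  consider "occ (W c j) (W c i) r" | "len i \<le> r" "occ (W c j) (W (\<not> c) a @ W c i) (r - len i)" by auto
  then show ?thesis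
  proof cases
    case 2
    show ?thesis
      using no_straddle'[OF j(1) 2(2) suffix_W[OF j(3)] prefix_W[OF j(2)]] 2
      by (simp add: le_diff_conv2 add.commute[of "len a"])
  qed simp
qed

lemma occ_zone':
  assumes j: "m \<le> j" "j \<le> a" "j - m \<le> i"
    and r: "occ (W c j) (W (\<not> c) i @ W c a @ W (\<not> c) i) r"
  shows "occ (W c j) (W (\<not> c) i) r \<or> (len i \<le> r \<and> occ (W c j) (W c a) (r - len i)) \<or>
         (len i + len a \<le> r \<and> occ (W c j) (W (\<not> c) i) (r - (len i + len a)))"
proof -
  from no_straddle'[OF j(1) r suffix_W[OF j(3)] prefix_prefix[OF prefix_W[OF j(2)]]]
  consider "occ (W c j) (W (\<not> c) i) r" | "len i \<le> r" "occ (W c j) (W c a @ W (\<not> c) i) (r - len i)" by auto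
  then show ?thesis
  proof cases
    case 2
    show ?thesis
      using no_straddle[OF j(1) 2(2) suffix_W[OF j(2)] prefix_W[OF j(3)]] 2
      by (simp add: le_diff_conv2 add.commute[of "len a"])
  qed simp
qed

section \<open>Occurrences in words of the opposite letter\<close>

lemma occ_centre_aux:
  assumes N: "\<And>r. \<not> occ (W c j) (W (\<not> c) (j + m)) r"
    and r: "occ (W c j) (W (\<not> c) (Suc (j + m))) r"
  shows "r = len (j + m)"
proof -
  let ?Q = "W (\<not> c) (j + m)"
  have st: "W (\<not> c) (Suc (j + m)) = ?Q @ W c j @ ?Q" using W_step[of "j + m" "\<not> c"] by simp
  show ?thesis
  proof (cases "m \<le> j")
    case True
    have "r = len (j + m)" if "len (j + m) \<le> r" "occ (W c j) (W c j) (r - len (j + m))"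
      using that by (auto simp: occ_W)
    then show ?thesis using occ_zone'[OF True, of j "j + m" c r] r N unfolding st by auto
  next
    case False
    \<comment> \<open>Below rank \<open>m\<close> the seam lemmas do not apply, but there the word
      is a power of \<open>c\<close>, and \<open>?Q\<close> begins and ends with
      \<open>\<not> c\<close>.\<close>
    have W: "W c j = replicate (Suc j) c" and lj: "len j = Suc j"
      using False by (simp_all add: W_base len_base del: replicate.simps)
    let ?X = "?Q @ W c j @ ?Q"
    have le: "r + Suc j \<le> length ?X" using r unfolding st by (auto simp: occ_W lj)
    have eqc: "?X ! k = c" if "r \<le> k" "k \<le> r + j" for k
    proof -
      have "W c j ! (k - r) = c" using that W by (simp del: replicate.simps)
      moreover have "?X ! (r + (k - r)) = W c j ! (k - r)"
        using r that lj unfolding st occ_def length_W by (metis le_imp_less_Suc le_diff_conv add.commute)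
      ultimately show ?thesis using that by simp
    qed
    have "?X ! (len (j + m) - 1) = rev ?Q ! 0"
      by (subst rev_nth) (auto simp: nth_append)
    then have q1: "?X ! (len (j + m) - 1) = (\<not> c)" by (simp add: W_nth)
    have q2: "?X ! (len (j + m) + Suc j) = (\<not> c)" by (simp add: nth_append lj W_nth)
    have a1: "\<not> (r \<le> len (j + m) - 1 \<and> len (j + m) - 1 \<le> r + j)" using eqc q1 by blast
    have a2: "\<not> (r \<le> len (j + m) + Suc j \<and> len (j + m) + Suc j \<le> r + j)" using eqc q2 by blast
    have pos: "0 < len (j + m)" by simp
    consider "r + Suc j \<le> len (j + m)" | "r = len (j + m)" | "len (j + m) + Suc j \<le> r"
      using a1 a2 pos by linarith
    then show ?thesis
    proof cases
      case 1
      then show ?thesis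
        using occ_drop_context[of "W c j" "[]" ?Q "W c j @ ?Q" r] r N unfolding st by (simp add: lj)
    next
      case 3
      then show ?thesis
        using occ_drop_context[of "W c j" "?Q @ W c j" ?Q "[]" r] r N le unfolding st by (simp add: lj)
    qed
  qed
qed

text \<open>\<open>W c (Suc j)\<close> begins and ends with \<open>W c j\<close>, and by induction
  both of these copies would have to be the central one.\<close>

lemma not_occ_opposite: "\<not> occ (W c j) (W (\<not> c) (j + m)) r"
proof (induction j arbitrary: r)
  case 0
  have "W (\<not> c) m ! r = (\<not> c)" if "r < len m" using that by (simp add: W_base len_base del: replicate.simps)
  then show ?case by (auto simp: occ_W len_base)
next
  case (Suc j)
  show ?case
  proof
    assume r: "occ (W c (Suc j)) (W (\<not> c) (Suc j + m)) r"
    have "r = len (j + m)"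
      by (rule occ_centre_aux[OF Suc.IH]) (use occ_W_le[OF r, of j] in simp)
    moreover have "r + (len (Suc j) - len j) = len (j + m)"
      by (rule occ_centre_aux[OF Suc.IH]) (use occ_W_le_right[OF r, of j] in simp)
    ultimately show False using len_less_Suc[of j] by linarith
  qed
qed

lemmas occ_centre = occ_centre_aux[OF not_occ_opposite]

lemma not_occ_opposite_le: "i \<le> j + m \<Longrightarrow> \<not> occ (W c j) (W (\<not> c) i) r"
  using not_occ_opposite[of c j] prefix_W[of i "j + m" "\<not> c"]
  by (metis add_0 occ_left occ_trans prefix_def)

text \<open>The three roles that the recursion gives to \<open>W c n\<close>: left part, right part,
  marker.\<close>

definition placed :: "bool \<Rightarrow> nat \<Rightarrow> bool list \<Rightarrow> nat \<Rightarrow> bool" where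
  "placed c n x r \<longleftrightarrow>
     occ (W c (Suc n)) x r \<or>
     (\<exists>q. q + (len n + len (n - m)) = r \<and> occ (W c (Suc n)) x q) \<or>
     (\<exists>q. q + len (n + m) = r \<and> occ (W (\<not> c) (Suc (n + m))) x q)"

lemma placed_trans:
  assumes "placed c n x r" and y: "occ x y s"
  shows "placed c n y (s + r)"
  using assms(1) unfolding placed_def
proof (elim disjE exE conjE)
  fix q assume "q + (len n + len (n - m)) = r" "occ (W c (Suc n)) x q"
  then show "occ (W c (Suc n)) y (s + r) \<or>
      (\<exists>q. q + (len n + len (n - m)) = s + r \<and> occ (W c (Suc n)) y q) \<or>
      (\<exists>q. q + len (n + m) = s + r \<and> occ (W (\<not> c) (Suc (n + m))) y q)"
    using occ_trans[OF _ y] by (intro disjI2 disjI1 exI[of _ "s + q"]) auto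
next
  fix q assume "q + len (n + m) = r" "occ (W (\<not> c) (Suc (n + m))) x q"
  then show "occ (W c (Suc n)) y (s + r) \<or>
      (\<exists>q. q + (len n + len (n - m)) = s + r \<and> occ (W c (Suc n)) y q) \<or>
      (\<exists>q. q + len (n + m) = s + r \<and> occ (W (\<not> c) (Suc (n + m))) y q)"
    using occ_trans[OF _ y] by (intro disjI2 exI[of _ "s + q"]) auto
qed (use occ_trans[OF _ y] in blast)

lemma occ_self: "occ x x 0" by (simp add: occ_def)

text \<open>Occurrences do not cross seams, so one can descend into a component until
  \<open>W c n\<close> itself is a component of the enclosing word.\<close>

lemma occ_placed:
  assumes n: "m \<le> n"
  shows "occ (W c n) (W e N) r \<Longrightarrow> (e = c \<and> N = n \<and> r = 0) \<or> placed c n (W e N) r"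
proof (induction N arbitrary: e r rule: less_induct)
  case (less N)
  have len: "r + len n \<le> len N" using less.prems by (auto simp: occ_W)
  then have nN: "n \<le> N" by (metis len_le_iff le_add2 le_trans)
  have sub: "placed c n (W e N) r"
    if "occ (W e' N') (W e N) s" "s \<le> r" "N' < N" "e' \<noteq> c \<or> N' \<noteq> n"
      "occ (W c n) (W e' N') (r - s)" for e' N' s
  proof -
    have "placed c n (W e' N') (r - s)" using less.IH[OF that(3,5)] that(4) by blast
    from placed_trans[OF this that(1)] show ?thesis using that(2) by simp
  qed
  show ?case
  proof (cases "e = c")
    case True
    show ?thesis
    proof (cases "N = n")
      case True
      then show ?thesis using len \<open>e = c\<close> by simp
    next
      case False
      then obtain k where k: "N = Suc k" "n \<le> k" "m \<le> k" using nN n by (cases N) auto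
      have st: "W e N = W c k @ W (\<not> c) (k - m) @ W c k"
        unfolding \<open>e = c\<close> k(1) by (rule W_step[OF k(3)])
      show ?thesis
      proof (cases "k = n")
        case True
        have "occ (W c n) (W c (Suc n)) r" using less.prems \<open>e = c\<close> k True by simp
        from occ_Suc_ends[OF n this] show ?thesis
          using occ_self[of "W c N"] \<open>e = c\<close> k True unfolding placed_def by fastforce
      next
        case False
        have o: "occ (W c k) (W e N) 0" "occ (W (\<not> c) (k - m)) (W e N) (len k)"
          "occ (W c k) (W e N) (len k + len (k - m))"
          using occ_left[of "W c k"] occ_middle[of "W (\<not> c) (k - m)" "W c k"]
            occ_right[of "W c k" "W c k @ W (\<not> c) (k - m)"] unfolding st by simp_all
        have lt: "k < N" "k - m < N" using k by simp_all
        have "occ (W c n) (W c k @ W (\<not> c) (k - m) @ W c k) r" using less.prems unfolding st .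
        from occ_zone[OF n k(2) diff_le_mono[OF k(2)] this]
        consider "occ (W c n) (W c k) r"
          | "len k \<le> r" "occ (W c n) (W (\<not> c) (k - m)) (r - len k)"
          | "len k + len (k - m) \<le> r" "occ (W c n) (W c k) (r - (len k + len (k - m)))" by blast
        then have "placed c n (W e N) r"
        proof cases
          case 1
          then show ?thesis using sub[OF o(1) _ lt(1)] False by simp
        next
          case 2
          then show ?thesis using sub[OF o(2) 2(1) lt(2)] by simp
        next
          case 3
          then show ?thesis using sub[OF o(3) 3(1) lt(1)] False by simp
        qed
        then show ?thesis ..
      qed
    qed
  next
    case False
    then have e: "e = (\<not> c)" by auto
    have N: "n + m < N" using less.prems not_occ_opposite_le[of N n c r] unfolding e by force
    then obtain k where k: "N = Suc k" "n + m \<le> k" by (cases N) auto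
    have mk: "m \<le> k" "n \<le> k - m" "n - m \<le> k" using k by linarith+
    have st: "W e N = W (\<not> c) k @ W c (k - m) @ W (\<not> c) k"
      using W_step[OF mk(1), of "\<not> c"] unfolding e k(1) by simp
    show ?thesis
    proof (cases "k = n + m")
      case True
      have "occ (W c n) (W (\<not> c) (Suc (n + m))) r" using less.prems e k True by simp
      from occ_centre[OF this] show ?thesis
        using occ_self[of "W e N"] e k True unfolding placed_def by fastforce
    next
      case False
      have o: "occ (W (\<not> c) k) (W e N) 0" "occ (W c (k - m)) (W e N) (len k)"
        "occ (W (\<not> c) k) (W e N) (len k + len (k - m))"
        using occ_left[of "W (\<not> c) k"] occ_middle[of "W c (k - m)" "W (\<not> c) k"]
          occ_right[of "W (\<not> c) k" "W (\<not> c) k @ W c (k - m)"] unfolding st by simp_all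
      have lt: "k < N" "k - m < N" "k - m \<noteq> n" using k False by linarith+
      have "occ (W c n) (W (\<not> c) k @ W c (k - m) @ W (\<not> c) k) r" using less.prems unfolding st .
      from occ_zone'[OF n mk(2,3) this]
      consider "occ (W c n) (W (\<not> c) k) r"
        | "len k \<le> r" "occ (W c n) (W c (k - m)) (r - len k)"
        | "len k + len (k - m) \<le> r" "occ (W c n) (W (\<not> c) k) (r - (len k + len (k - m)))" by blast
      then have "placed c n (W e N) r"
      proof cases
        case 1
        then show ?thesis using sub[OF o(1) _ lt(1)] by simp
      next
        case 2
        then show ?thesis using sub[OF o(2) 2(1) lt(2)] lt(3) by simp
      next
        case 3
        then show ?thesis using sub[OF o(3) 3(1) lt(1)] by simp
      qed
      then show ?thesis ..
    qed
  qed
qed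

text \<open>Left parts and centres show directly what comes next. A right part ends together with a
  \<open>W c (Suc k)\<close>, so the claim moves to the next rank, whose marker starts with the one
  wanted; hence the induction on \<open>N - k\<close>.\<close>

lemma followed:
  assumes "m \<le> k" "occ (W c k) (W e N) r"
  shows "r + len k = len N \<or> occ (W (\<not> c) (k - m)) (W e N) (r + len k)"
  using assms
proof (induction "N - k" arbitrary: k r rule: less_induct)
  case less
  have len: "r + len k \<le> len N" using less.prems by (auto simp: occ_W)
  from occ_placed[OF less.prems]
  consider "N = k" "r = 0" | "occ (W c (Suc k)) (W e N) r"
    | q where "q + (len k + len (k - m)) = r" "occ (W c (Suc k)) (W e N) q"
    | q where "q + len (k + m) = r" "occ (W (\<not> c) (Suc (k + m))) (W e N) q"
    unfolding placed_def by blast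
  then show ?case
  proof cases
    case 2
    moreover have "occ (W (\<not> c) (k - m)) (W c (Suc k)) (len k)"
      using occ_middle[of "W (\<not> c) (k - m)" "W c k"] less.prems by (simp add: W_step)
    ultimately show ?thesis by (auto dest: occ_trans)
  next
    case 3
    have "q + len (Suc k) \<le> len N" using 3 by (auto simp: occ_W)
    then have "Suc k \<le> N" by (metis len_le_iff le_add2 le_trans)
    moreover have "q + len (Suc k) = r + len k" using 3 less.prems by (simp add: len_step)
    ultimately have "r + len k = len N \<or> occ (W (\<not> c) (Suc k - m)) (W e N) (r + len k)"
      using less.hyps[of "Suc k" q] 3(2) less.prems by auto
    then show ?thesis by (auto intro: occ_W_le)
  next
    case 4
    have "W (\<not> c) (Suc (k + m)) = (W (\<not> c) (k + m) @ W c k) @ W (\<not> c) (k + m)"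
      using W_step[of "k + m" "\<not> c"] by simp
    then have "occ (W (\<not> c) (k + m)) (W (\<not> c) (Suc (k + m))) (len (k + m) + len k)"
      using occ_right[of "W (\<not> c) (k + m)" "W (\<not> c) (k + m) @ W c k"] by simp
    then have "occ (W (\<not> c) (k + m)) (W e N) (r + len k)"
      using occ_trans[OF _ 4(2)] 4(1) by (metis add.assoc)
    then show ?thesis by (auto intro: occ_W_le)
  qed simp
qed

lemma preceded:
  assumes "m \<le> k" "occ (W c k) (W e N) r"
  shows "r = 0 \<or> (\<exists>q. q + len (k - m) = r \<and> occ (W (\<not> c) (k - m)) (W e N) q)"
proof -
  have len: "r + len k \<le> len N" using assms by (auto simp: occ_W)
  have "occ (W c k) (W e N) (len N - len k - r)" using occ_W_rev[OF assms(2)] by simp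
  from followed[OF assms(1) this] len
  consider "r = 0" | "occ (W (\<not> c) (k - m)) (W e N) (len N - r)" by fastforce
  then show ?thesis
  proof cases
    case 2
    have "len (k - m) \<le> r" using 2 len by (auto simp: occ_W)
    then show ?thesis
      using occ_W_rev[OF 2] len by (intro disjI2 exI[of _ "r - len (k - m)"]) simp
  qed simp
qed

lemma occ_distance:
  assumes "m \<le> n" "occ (W c n) (W e N) r" "occ (W c n) (W e N) (r + p)" "0 < p"
  shows "len n \<le> p"
proof (rule ccontr)
  assume "\<not> len n \<le> p"
  then have p: "p < len n" by linarith
  have "r + p + len n \<le> len N" using assms(3) by (auto simp: occ_W)
  then have "r + len n \<noteq> len N" using assms(4) by linarith
  then show False
    using followed[OF assms(1,2)] no_overlap[OF assms(1-4) p] by blast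
qed

section \<open>Runs in marker words\<close>

text \<open>The factor 3 covers the worst window: less than \<open>len k\<close> at the end of one
  component, a marker of length at most \<open>len k\<close>, and \<open>len k\<close> for the start
  of the next component. A longer marker begins and ends with a word of rank \<open>k\<close>
  itself.\<close>

lemma cover:
  assumes k: "m \<le> k"
  shows "i + 3 * len k \<le> len N \<Longrightarrow> \<exists>c r. i \<le> r \<and> r + len k \<le> i + 3 * len k \<and> occ (W c k) (W e N) r"
proof (induction N arbitrary: e i rule: less_induct)
  case (less N)
  have kp: "0 < len k" by simp
  have "len k < len N" using less.prems kp by linarith
  then have "k < N" by simp
  then obtain n where n: "N = Suc n" "k \<le> n" "m \<le> n" using k by (cases N) auto
  let ?Q = "W (\<not> e) (n - m)"
  have lN: "len N = 2 * len n + len (n - m)" using n by (simp add: len_step)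
  have st: "W e N = W e n @ ?Q @ W e n" using n by (simp add: W_step)
  have o: "occ (W e n) (W e N) 0" "occ ?Q (W e N) (len n)" "occ (W e n) (W e N) (len n + len (n - m))"
    using occ_left[of "W e n"] occ_middle[of ?Q "W e n"] occ_right[of "W e n" "W e n @ ?Q"]
    unfolding st by simp_all
  have kn: "len k \<le> len n" using n by simp
  consider "i + 3 * len k \<le> len n" | "len n + len (n - m) \<le> i"
    | "i \<le> len n - len k" "len n \<le> i + 3 * len k"
    | "i \<le> len n + len (n - m)" "len n + len (n - m) + len k \<le> i + 3 * len k"
    | "len n - len k < i" "i \<le> len n" "i + 3 * len k < len n + len (n - m) + len k"
    | "len n < i" "i + 3 * len k \<le> len n + len (n - m)"
    | "len n < i" "len n + len (n - m) \<le> i + 3 * len k" "i + 3 * len k < len n + len (n - m) + len k"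
    by linarith
  then show ?case
  proof cases
    case 1
    then obtain c r where "i \<le> r" "r + len k \<le> i + 3 * len k" "occ (W c k) (W e n) r"
      using less.IH[of n i e] n by auto
    then show ?thesis using occ_trans[OF _ o(1)] by fastforce
  next
    case 2
    define i' where "i' = i - (len n + len (n - m))"
    have i': "i = len n + len (n - m) + i'" using 2 by (simp add: i'_def)
    then have "i' + 3 * len k \<le> len n" using less.prems lN by linarith
    then obtain c r where "i' \<le> r" "r + len k \<le> i' + 3 * len k" "occ (W c k) (W e n) r"
      using less.IH[of n i' e] n by auto
    then show ?thesis using occ_trans[OF _ o(3), of "W c k" r]
      by (intro exI[of _ c] exI[of _ "len n + len (n - m) + r"]) (auto simp: i')
  next
    case 3
    have "occ (W e k) (W e N) (0 + (len n - len k))"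
      by (rule occ_W_le_right[OF o(1) n(2)])
    then show ?thesis using 3 kn by (intro exI[of _ e] exI[of _ "len n - len k"]) auto
  next
    case 4
    have "occ (W e k) (W e N) (len n + len (n - m))" by (rule occ_W_le[OF o(3) n(2)])
    then show ?thesis using 4 by blast
  next
    case 5
    have "len k < len (n - m)" using 5 kn kp by linarith
    then have "k \<le> n - m" by simp
    from occ_W_le[OF o(2) this] 5 show ?thesis
      by (intro exI[of _ "\<not> e"] exI[of _ "len n"]) auto
  next
    case 6
    define i' where "i' = i - len n"
    have i': "i = len n + i'" using 6 by (simp add: i'_def)
    then have "i' + 3 * len k \<le> len (n - m)" using 6 by linarith
    then obtain c r where "i' \<le> r" "r + len k \<le> i' + 3 * len k" "occ (W c k) ?Q r"
      using less.IH[of "n - m" i' "\<not> e"] n by (metis diff_le_self le_imp_less_Suc)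
    then show ?thesis using occ_trans[OF _ o(2), of "W c k" r]
      by (intro exI[of _ c] exI[of _ "len n + r"]) (auto simp: i')
  next
    case 7
    have lt: "len k < len (n - m)" using 7 kn kp by linarith
    then have "k \<le> n - m" by simp
    from occ_W_le_right[OF o(2) this] 7 lt show ?thesis
      by (intro exI[of _ "\<not> e"] exI[of _ "len n + (len (n - m) - len k)"]) auto
  qed
qed

text \<open>Makes markers short against the words they separate. Both sides obey the same recursion,
  so only the initial ranks, where \<open>len\<close> grows by one, need separate care.\<close>

lemma len_scale: "Suc m * len n \<le> len (n + m)"
proof (induction n rule: less_induct)
  case (less n)
  show ?case
  proof (cases n)
    case 0
    then show ?thesis by (simp add: len_base)
  next
    case (Suc k)
    have IH: "Suc m * len k \<le> len (k + m)" using less Suc by blast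
    have st: "len (n + m) = 2 * len (k + m) + len k" using len_step[of "k + m"] Suc by simp
    show ?thesis
    proof (cases "m \<le> k")
      case True
      have "Suc m * len (k - m) \<le> len (k - m + m)" using less Suc by (simp add: less_Suc_eq_le)
      then have "Suc m * len (k - m) \<le> len k" using True by simp
      moreover have "Suc m * len n = 2 * (Suc m * len k) + Suc m * len (k - m)"
        using True Suc by (simp add: len_step algebra_simps)
      ultimately show ?thesis using IH st by linarith
    next
      case False
      then have "len n = len k + 1" "1 \<le> len k" using Suc by (simp_all add: len_base)
      then have "Suc m * len n \<le> Suc m * (2 * len k)" by (intro mult_le_mono2) linarith
      then show ?thesis using IH st by linarith
    qed
  qed
qed

lemma len_scale': "m \<le> n \<Longrightarrow> Suc m * len (n - m) \<le> len n"
  using len_scale[of "n - m"] by simp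

lemma len_Suc_le: "len (Suc n) \<le> 3 * len n"
proof (cases "m \<le> n")
  case True
  moreover have "len (n - m) \<le> len n" by simp
  ultimately show ?thesis unfolding len_step[OF True] by linarith
qed (simp add: len_base)

text \<open>\<open>t - s\<close> counts agreements, so the repetition itself has length
  \<open>t - s + p\<close>.\<close>

definition is_run :: "bool list \<Rightarrow> nat \<Rightarrow> nat \<Rightarrow> nat \<Rightarrow> bool" where
  "is_run x p s t \<longleftrightarrow> s \<le> t \<and> t + p \<le> length x \<and> (\<forall>k. s \<le> k \<and> k < t \<longrightarrow> x ! k = x ! (k + p))"

text \<open>Let \<open>n\<close> be the largest rank of a word \<open>W c n\<close> that occurs inside the run, at position \<open>r\<close> say. By
  maximality the occurrences at \<open>r\<close> and \<open>r + p\<close> are not both left parts, and not both right parts, of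
  \<open>W c (Suc n)\<close>. If they are of opposite kinds, then the run ends at a mismatch on either side; if
  one of them is the centre of a word \<open>W (\<not> c) (Suc (n + m))\<close>, then \<open>p\<close> is at least
  \<open>len (n + m)\<close>, while the run is shorter than \<open>9 * len n\<close>.\<close>

lemma run_bound_maximal:
  fixes e :: bool and N :: nat
  defines "x \<equiv> W e N"
  assumes p: "0 < p" and run: "is_run x p s t" and long: "3 * len m \<le> t - s"
    and max: "\<And>s' t'. is_run x p s' t' \<Longrightarrow> t' - s' \<le> t - s"
  shows "Suc m * (t - s) \<le> (m + 10) * p"
proof -
  have st: "s \<le> t" "t + p \<le> len N" using run by (auto simp: is_run_def x_def)
  define S where "S = {n. m \<le> n \<and> (\<exists>c r. s \<le> r \<and> r + len n \<le> t \<and> occ (W c n) x r)}"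
  have cov: "n \<in> S" if "m \<le> n" "3 * len n \<le> t - s" for n
  proof -
    have "s + 3 * len n \<le> len N" using that(2) st by linarith
    from cover[OF that(1) this, of e] obtain c r where
      "s \<le> r" "r + len n \<le> s + 3 * len n" "occ (W c n) x r" unfolding x_def by blast
    moreover have "r + len n \<le> t" using calculation(2) that(2) st by linarith
    ultimately show ?thesis using that(1) unfolding S_def by blast
  qed
  have "S \<subseteq> {..<len N}"
  proof
    fix n assume "n \<in> S"
    then obtain r where "r + len n \<le> t" unfolding S_def by blast
    then have "len n \<le> len N" using st by linarith
    then have "n < len N" using len_gt[of n] by linarith
    then show "n \<in> {..<len N}" by simp
  qed
  then have fin: "finite S" by (rule finite_subset) simp
  define n where "n = Max S"
  have nS: "n \<in> S" unfolding n_def by (rule Max_in[OF fin]) (use cov[of m] long in blast)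
  have nmax: "k \<le> n" if "k \<in> S" for k unfolding n_def by (rule Max_ge[OF fin that])
  obtain c r where n: "m \<le> n" and r: "s \<le> r" "r + len n \<le> t" and o: "occ (W c n) x r"
    using nS unfolding S_def by blast
  have o': "occ (W c n) x (r + p)"
    unfolding occ_W
  proof (intro conjI allI impI)
    show "r + p + len n \<le> length x" using r st by (simp add: x_def)
    fix k assume "k < len n"
    then have "x ! (r + k) = x ! (r + k + p)" "x ! (r + k) = Winf c k"
      using run r o by (auto simp: is_run_def occ_W)
    then show "x ! (r + p + k) = Winf c k" by (simp add: add_ac)
  qed
  have pn: "len n \<le> p" using occ_distance[OF n, of c e N r p] o o' p unfolding x_def by blast
  have "\<not> 3 * len (Suc n) \<le> t - s"
    using cov[of "Suc n"] nmax[of "Suc n"] n by auto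
  \<comment> \<open>Otherwise \<open>cover\<close> would put a word of rank \<open>Suc n\<close>
    into the run; \<open>len\<close> at most triples per rank, hence 9.\<close>
  then have short: "t - s < 9 * len n" using len_Suc_le[of n] by linarith
  \<comment> \<open>A word of larger rank that meets the run and recurs \<open>p\<close> later would
    prolong it; as the run is longest, the word lies inside, against the choice of
    \<open>n\<close>.\<close>
  have ext: False
    if "occ (W d k) x q" "occ (W d k) x (q + p)" "q \<le> t" "s \<le> q + len k" "n < k" for d k q
  proof -
    let ?s = "min s q" and ?t = "max t (q + len k)"
    have "q + p + len k \<le> length x" using that(2) by (auto simp: occ_W)
    moreover have "x ! h = x ! (h + p)" if "?s \<le> h" "h < ?t" for h
    proof (cases "s \<le> h \<and> h < t")
      case True
      then show ?thesis using run by (simp add: is_run_def)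
    next
      case False
      then have "q \<le> h" "h - q < len k" using that \<open>q \<le> t\<close> \<open>s \<le> q + len k\<close> by linarith+
      then have "x ! (q + (h - q)) = Winf d (h - q)" "x ! (q + p + (h - q)) = Winf d (h - q)"
        using \<open>occ (W d k) x q\<close> \<open>occ (W d k) x (q + p)\<close> unfolding occ_W by blast+
      then show ?thesis using \<open>q \<le> h\<close> by (simp add: add_ac)
    qed
    ultimately have "is_run x p ?s ?t" using st unfolding is_run_def by (auto simp: x_def)
    then have "?t - ?s \<le> t - s" by (rule max)
    then have "s \<le> q" "q + len k \<le> t" using st that by linarith+
    then have "k \<in> S" using that n unfolding S_def by auto
    then show False using nmax \<open>n < k\<close> by fastforce
  qed
  have nN: "\<not> (e = c \<and> N = n \<and> r = 0)" "\<not> (e = c \<and> N = n \<and> r + p = 0)"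
    using o' p by (auto simp: occ_W x_def)
  have placed: "placed c n x r" "placed c n x (r + p)"
    using occ_placed[OF n, of c e N] o o' nN unfolding x_def by blast+
  have far: ?thesis if "len (n + m) \<le> p"
  proof -
    have "Suc m * (t - s) \<le> Suc m * (9 * len n)" using short by (intro mult_le_mono2) simp
    also have "\<dots> = 9 * (Suc m * len n)" by simp
    also have "\<dots> \<le> 9 * p" using len_scale[of n] that by linarith
    finally show ?thesis by (simp add: algebra_simps)
  qed
  let ?L = "\<lambda>r. occ (W c (Suc n)) x r"
  let ?R = "\<lambda>r. \<exists>q. q + (len n + len (n - m)) = r \<and> occ (W c (Suc n)) x q"
  let ?M = "\<lambda>r. \<exists>q. q + len (n + m) = r \<and> occ (W (\<not> c) (Suc (n + m))) x q"
  have stQ: "W (\<not> c) (Suc (n + m)) = W (\<not> c) (n + m) @ W c n @ W (\<not> c) (n + m)"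
    using W_step[of "n + m" "\<not> c"] by simp
  \<comment> \<open>For smaller \<open>p\<close> the copy at \<open>r + p\<close> would lie in the
    \<open>W (\<not> c) (n + m)\<close> right of the centre, where \<open>W c n\<close> cannot
    occur.\<close>
  have M1: ?thesis if M: "?M r"
  proof (rule ccontr)
    assume "\<not> ?thesis"
    then have "p < len (n + m)" using far by linarith
    obtain q where q: "q + len (n + m) = r" "occ (W (\<not> c) (Suc (n + m))) x q" using M by blast
    then have oQ: "occ (W (\<not> c) (n + m)) x (r + len n)"
      using occ_trans[OF occ_right q(2)[unfolded stQ append_assoc[symmetric]]] q(1)[symmetric]
      by (simp add: add.assoc)
    have "occ (W c n) (W (\<not> c) (n + m)) (p - len n)"
      unfolding occ_W
    proof (intro conjI allI impI)
      show "p - len n + len n \<le> length (W (\<not> c) (n + m))" using pn \<open>p < len (n + m)\<close> by simp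
      fix k assume k: "k < len n"
      have "p - len n + k < len (n + m)" using k pn \<open>p < len (n + m)\<close> by linarith
      then have "x ! (r + len n + (p - len n + k)) = W (\<not> c) (n + m) ! (p - len n + k)"
        using oQ unfolding occ_def length_W by blast
      moreover have "x ! (r + p + k) = Winf c k" using o' k by (auto simp: occ_W)
      ultimately show "W (\<not> c) (n + m) ! (p - len n + k) = Winf c k" using pn by (simp add: add_ac)
    qed
    then show False using not_occ_opposite by blast
  qed
  have M2: ?thesis if M: "?M (r + p)"
  proof (rule ccontr)
    assume "\<not> ?thesis"
    then have "p < len (n + m)" using far by linarith
    obtain q where q: "q + len (n + m) = r + p" "occ (W (\<not> c) (Suc (n + m))) x q" using M by blast
    then have oQ: "occ (W (\<not> c) (n + m)) x q"
      using occ_trans[OF occ_left[of "W (\<not> c) (n + m)"], of _ x q] by (simp add: stQ)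
    have qr: "q \<le> r" using q \<open>p < len (n + m)\<close> by linarith
    have "occ (W c n) (W (\<not> c) (n + m)) (r - q)"
      unfolding occ_W
    proof (intro conjI allI impI)
      show "r - q + len n \<le> length (W (\<not> c) (n + m))" using pn q qr by simp
      fix k assume k: "k < len n"
      have "r - q + k < len (n + m)" using k pn q qr by linarith
      then have "x ! (q + (r - q + k)) = W (\<not> c) (n + m) ! (r - q + k)"
        using oQ by (auto simp: occ_def)
      moreover have "x ! (r + k) = Winf c k" using o k by (auto simp: occ_W)
      ultimately show "W (\<not> c) (n + m) ! (r - q + k) = Winf c k" using qr by simp
    qed
    then show False using not_occ_opposite by blast
  qed
  have LL: False if "?L r" "?L (r + p)"
    using ext[OF that] r by simp
  have RR: False if "?R r" "?R (r + p)"
  proof -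
    obtain q where q: "q + (len n + len (n - m)) = r" "occ (W c (Suc n)) x q"
      using \<open>?R r\<close> by (elim exE conjE)
    obtain q' where q': "q' + (len n + len (n - m)) = r + p" "occ (W c (Suc n)) x q'"
      using \<open>?R (r + p)\<close> by (elim exE conjE)
    have "q' = q + p" using q q' by linarith
    then have "occ (W c (Suc n)) x (q + p)" using q' by simp
    moreover have "q \<le> t" "s \<le> q + len (Suc n)" using q r st n by (simp_all add: len_step)
    ultimately show False using ext[OF q(2)] by blast
  qed
  obtain d where d: "mismatch n d" using mismatch_exists by blast
  have dl: "len n + d < len (Suc n)" and dm: "d < len (Suc n - m)" using d by (auto simp: mismatch_def)
  have dneq: "Winf c (len n + d) \<noteq> Winf (\<not> c) d" using d by (auto simp: mismatch_def)
  \<comment> \<open>With opposite roles, \<open>followed\<close> and \<open>preceded\<close> put a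
    marker of rank \<open>Suc n - m\<close> next to one copy, where the other continues inside
    \<open>W c (Suc n)\<close>; \<open>mismatch n\<close> ends the run at most \<open>d\<close>
    letters beyond the copy on either side.\<close>
  have LR: ?thesis if L: "?L r1" and R: "?R r2" and r12: "r1 = r \<and> r2 = r + p \<or> r1 = r + p \<and> r2 = r" for r1 r2
  proof -
    obtain q where q: "q + (len n + len (n - m)) = r2" "occ (W c (Suc n)) x q" using R by blast
    have qS: "q + len (Suc n) = r2 + len n" using q n by (simp add: len_step)
    have "t \<le> r + len n + d"
    proof (rule ccontr)
      assume neg: "\<not> ?thesis"
      then have lt: "r + p + len n + d < len N" using st by linarith
      have "m \<le> Suc n" using n by simp
      then have "r2 + len n = len N \<or> occ (W (\<not> c) (Suc n - m)) x (r2 + len n)"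
        using followed[of "Suc n" c e N q] q(2) qS unfolding x_def by auto
      then have "occ (W (\<not> c) (Suc n - m)) x (r2 + len n)" using lt r12 by auto
      then have "x ! (r2 + len n + d) = Winf (\<not> c) d" using dm by (auto simp: occ_W)
      moreover have "x ! (r1 + (len n + d)) = Winf c (len n + d)" using L dl by (auto simp: occ_W)
      moreover have "x ! (r + len n + d) = x ! (r + len n + d + p)"
        using run neg r by (auto simp: is_run_def)
      ultimately show False using r12 dneq by (auto simp: add_ac)
    qed
    moreover have "r \<le> s + d"
    proof (rule ccontr)
      assume neg: "\<not> ?thesis"
      have "m \<le> Suc n" using n by simp
      then have "r1 = 0 \<or> (\<exists>q. q + len (Suc n - m) = r1 \<and> occ (W (\<not> c) (Suc n - m)) x q)"
        using preceded[of "Suc n" c e N r1] L unfolding x_def by blast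
      moreover have "r1 \<noteq> 0" using neg r12 by auto
      ultimately obtain h where h: "h + len (Suc n - m) = r1" "occ (W (\<not> c) (Suc n - m)) x h" by blast
      have "len (Suc n - m) - Suc d < len (Suc n - m)" using dm by linarith
      then have "x ! (h + (len (Suc n - m) - Suc d)) = Winf (\<not> c) d"
        using h(2) unfolding occ_def length_W W_nth_rev[OF dm, symmetric] by blast
      moreover have "h + (len (Suc n - m) - Suc d) = r1 - Suc d" using h(1) dm by linarith
      moreover have "len (Suc n) - Suc (len n + d) < len (Suc n)" using dl by linarith
      then have "x ! (q + (len (Suc n) - Suc (len n + d))) = Winf c (len n + d)"
        using q(2) unfolding occ_def length_W W_nth_rev[OF dl, symmetric] by blast
      moreover have "q + (len (Suc n) - Suc (len n + d)) = r2 - Suc d" using qS dl by linarith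
      moreover have "s \<le> r - Suc d \<and> r - Suc d < t" using neg r len_pos[of n] by linarith
      then have "x ! (r - Suc d) = x ! (r - Suc d + p)"
        using run unfolding is_run_def by blast
      moreover have "r - Suc d + p = r + p - Suc d" using neg by linarith
      ultimately show False using r12 dneq by metis
    qed
    ultimately have ts: "t - s \<le> len n + 2 * d" by linarith
    have "Suc n - m = Suc (n - m)" using n by linarith
    then have "d \<le> 3 * len (n - m)" using dm len_Suc_le[of "n - m"] by simp
    then have "t - s \<le> len n + 6 * len (n - m)" using ts by linarith
    then have "Suc m * (t - s) \<le> Suc m * (len n + 6 * len (n - m))" by (rule mult_le_mono2)
    also have "\<dots> = Suc m * len n + 6 * (Suc m * len (n - m))" by (simp add: algebra_simps)
    also have "\<dots> \<le> Suc m * len n + 6 * len n" using len_scale'[OF n] by linarith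
    also have "\<dots> = (m + 7) * len n" by (simp add: algebra_simps)
    also have "\<dots> \<le> (m + 10) * p" using pn by (intro mult_le_mono) auto
    finally show ?thesis .
  qed
  show ?thesis using placed LL RR LR M1 M2 unfolding placed_def by blast
qed

lemma run_bound:
  assumes p: "0 < p" and run: "is_run (W e N) p s t" and long: "3 * len m \<le> t - s"
  shows "Suc m * (t - s) \<le> (m + 10) * p"
proof -
  let ?P = "\<lambda>(s, t). is_run (W e N) p s t"
  have "\<exists>x. ?P x \<and> (\<forall>y. ?P y \<longrightarrow> (\<lambda>(s, t). t - s) y \<le> (\<lambda>(s, t). t - s) x)"
    by (rule ex_has_greatest_nat[of ?P "(s, t)" _ "Suc (len N)"])
       (use run in \<open>auto simp: is_run_def\<close>)
  then obtain s' t' where *: "is_run (W e N) p s' t'"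
    "\<And>s t. is_run (W e N) p s t \<Longrightarrow> t - s \<le> t' - s'" by auto
  have le: "t - s \<le> t' - s'" using *(2) run .
  have "Suc m * (t' - s') \<le> (m + 10) * p"
    by (rule run_bound_maximal[OF p *(1)]) (use long le *(2) in auto)
  then show ?thesis using mult_le_mono2[OF le, of "Suc m"] by linarith
qed

section \<open>Marker words are rich\<close>

lemma W_last: "W c n ! (len n - Suc 0) = c"
  using rev_nth[of 0 "W c n"] by (simp add: W_nth)

text \<open>For \<open>j < m\<close> the word \<open>W c j\<close> also occurs in longer powers of
  \<open>c\<close>, so it is framed by \<open>\<not> c\<close>. A block of exactly
  \<open>Suc j\<close> letters cannot end at a seam preceded by \<open>Suc m\<close> letters
  \<open>c\<close>.\<close>

lemma isolated_run_no_straddle: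
  assumes j: "j < m" and r: "occ ([\<not> c] @ W c j @ [\<not> c]) (a @ b) r"
    and a: "suffix (W c m) a" and b: "prefix [\<not> c] b"
  shows "r + j + 3 \<le> length a \<or> length a \<le> r"
proof (rule ccontr)
  assume neg: "\<not> ?thesis"
  let ?t = "[\<not> c] @ W c j @ [\<not> c]"
  have lt: "length ?t = j + 3" using j by (simp add: len_base)
  have nth: "(a @ b) ! (r + k) = ?t ! k" if "k < j + 3" for k
    using r that unfolding occ_def lt by blast
  have Wj: "W c j ! k = c" if "k \<le> j" for k using j that by (simp add: W_base del: replicate.simps)
  obtain z where z: "a = z @ W c m" using a by (auto simp: suffix_def)
  have la: "length a = length z + Suc m" using z by (simp add: len_base)
  obtain y where y: "b = (\<not> c) # y" using b by (auto simp: prefix_def)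
  have B: "(a @ b) ! length a = (\<not> c)" by (simp add: y)
  define k where "k = length a - r"
  have k: "length a = r + k" "0 < k" "k < j + 3" using neg by (auto simp: k_def)
  \<comment> \<open>Only the closing frame letter can match the \<open>\<not> c\<close> that starts
    \<open>b\<close>.\<close>
  have "k = j + 2"
  proof (rule ccontr)
    assume "k \<noteq> j + 2"
    then have "k - 1 \<le> j" using k by linarith
    then have "?t ! k = c" using Wj[of "k - 1"] k j by (simp add: nth_Cons' nth_append len_base)
    then show False using nth[OF k(3)] B k by simp
  qed
  then have "r = length z + (m - Suc j)" using k(1) la j by linarith
  moreover have "m - Suc j < Suc m" by simp
  ultimately have "(a @ b) ! r = W c m ! (m - Suc j)" by (simp add: z nth_append len_base)
  then have "(a @ b) ! r = c" by (simp add: W_base del: replicate.simps)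
  then show False using nth[of 0] by simp
qed

lemma isolated_run_no_straddle':
  assumes j: "j < m" and r: "occ ([\<not> c] @ W c j @ [\<not> c]) (b @ a) r"
    and a: "prefix (W c m) a" and b: "suffix [\<not> c] b"
  shows "r + j + 3 \<le> length b \<or> length b \<le> r"
proof -
  have le: "r + (j + 3) \<le> length a + length b" using r j by (auto simp: occ_def len_base)
  have "length (b @ a) - length ([\<not> c] @ W c j @ [\<not> c]) - r = length a + length b - (j + 3) - r"
    using j by (simp add: len_base)
  from occ_rev[OF r, unfolded this]
  have "occ ([\<not> c] @ W c j @ [\<not> c]) (rev a @ rev b) (length a + length b - (j + 3) - r)" by simp
  from isolated_run_no_straddle[OF j this] a b le show ?thesis
    by (fastforce simp: suffix_to_prefix)
qed

text \<open>The block arises as the marker inside \<open>W (\<not> c) (Suc (j + m))\<close>, which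
  becomes a marker in words of \<open>c\<close> only from rank \<open>j + 2 * m + 2\<close> on;
  hence the bound.\<close>

lemma isolated_run_absent:
  assumes j: "j < m"
  shows "i \<le> j + 2 * m + 1 \<Longrightarrow> \<not> occ ([\<not> c] @ W c j @ [\<not> c]) (W c i) r"
proof (induction i arbitrary: r)
  case 0
  then show ?case by (simp add: occ_def W_base)
next
  case (Suc i)
  let ?t = "[\<not> c] @ W c j @ [\<not> c]"
  have lt: "length ?t = j + 3" using j by (simp add: len_base)
  have mid: "occ (W c j) x (r + 1)" if "occ ?t x r" for x r
    using occ_trans[OF occ_middle that] by simp
  show ?case
  proof (cases "m \<le> i")
    case False
    then have "Suc i \<le> m" by simp
    then have "W c (Suc i) ! r = c" if "r < len (Suc i)"
      using that by (simp add: W_base len_base del: replicate.simps)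
    then show ?thesis by (force simp: occ_def)
  next
    case True
    let ?Q = "W (\<not> c) (i - m)"
    have st: "W c (Suc i) = W c i @ ?Q @ W c i" by (rule W_step[OF True])
    show ?thesis
    proof
      assume o: "occ ?t (W c (Suc i)) r"
      have le: "r + (j + 3) \<le> len i + (len (i - m) + len i)" using o unfolding st occ_def lt by simp
      have p1: "prefix [\<not> c] (?Q @ W c i)" "suffix [\<not> c] (W c i @ ?Q)"
        using prefix_W[of 0 "i - m" "\<not> c"] suffix_W[of 0 "i - m" "\<not> c"]
        by (auto simp: W_base intro: suffix_appendI)
      from isolated_run_no_straddle[OF j o[unfolded st] suffix_W[OF True] p1(1)]
      have 1: "r + j + 3 \<le> len i \<or> len i \<le> r" by simp
      from isolated_run_no_straddle'[OF j, of c "W c i @ ?Q" "W c i" r] o p1(2) prefix_W[OF True, of c]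
      have 2: "r + j + 3 \<le> len i + len (i - m) \<or> len i + len (i - m) \<le> r" unfolding st by simp
      consider "r + j + 3 \<le> len i" | "len i \<le> r" "r + j + 3 \<le> len i + len (i - m)" | "len i + len (i - m) \<le> r"
        using 1 2 by linarith
      then show False
      proof cases
        case 1
        then show False
          using occ_drop_context[of ?t "[]" "W c i" "?Q @ W c i" r] o Suc unfolding st lt by simp
      next
        case 2
        then have "occ ?t ?Q (r - len i)"
          using occ_drop_context[of ?t "W c i" ?Q "W c i" r] o unfolding st lt by simp
        from mid[OF this] show False using not_occ_opposite_le[of "i - m" j c] Suc.prems by simp
      next
        case 3
        then show False
          using occ_drop_context[of ?t "W c i @ ?Q" "W c i" "[]" r] o Suc le unfolding st lt by simp
      qed
    qed
  qed
qed

text \<open>Reading \<open>W (\<not> c)\<close> after \<open>W c (Suc k)\<close>, the longest palindromic suffix is centred at the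
  last \<open>W c k\<close> for as long as the word is a prefix of the palindrome below.\<close>

lemma rich_word_first_phase:
  assumes k: "m \<le> k" and rich: "rich_word (W c (Suc k))"
    and r: "len (Suc k) \<le> r" "r \<le> len (Suc k) + len (k - m) + len k"
  shows "rich_word (take r (W c (Suc k) @ W (\<not> c) (k - m) @ W c k))"
proof (rule rich_word_closure_Suc)
  let ?Z = "W c (Suc k) @ W (\<not> c) (k - m) @ W c k"
  have ls: "len (Suc k) = 2 * len k + len (k - m)" using k by (rule len_step)
  have lz: "length ?Z = len (Suc k) + len (k - m) + len k" by simp
  have pos: "0 < len k" "0 < len (k - m)" by simp_all
  show "rev ?Z = ?Z" using k by (simp add: W_step)
  show "Suc (len (Suc k)) \<le> length ?Z" "length ?Z \<le> Suc (2 * len (Suc k))" "len (Suc k) \<le> r" "r \<le> length ?Z"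
    using r ls pos unfolding lz by linarith+
  show "rich_word (take (len (Suc k)) ?Z)" using rich by simp
  fix i
  let ?a = "length ?Z - Suc (len (Suc k))"
  let ?s = "drop ?a (take (Suc (len (Suc k))) ?Z)"
  have a: "?a + 1 = len k + len (k - m)" unfolding lz using pos by linarith
  assume o: "occ ?s (take (Suc (len (Suc k))) ?Z) i"
  have lt: "length (take (Suc (len (Suc k))) ?Z) = Suc (len (Suc k))"
    unfolding length_take lz using pos by linarith
  have lens: "length ?s = len k + 2" unfolding length_drop lt using a ls pos by linarith
  have ile: "i + (len k + 2) \<le> Suc (len (Suc k))" using o unfolding occ_def lens lt by blast
  have "occ (W c k) (W c (Suc k)) (i + 1)"
    unfolding occ_W
  proof (intro conjI allI impI)
    show "i + 1 + len k \<le> length (W c (Suc k))" using ile by simp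
    fix h assume h: "h < len k"
    have "h + 1 < len k + 2" using h by linarith
    then have 1: "take (Suc (len (Suc k))) ?Z ! (i + (h + 1)) = ?s ! (h + 1)"
      using o unfolding occ_def lens by blast
    have 2: "?s ! (h + 1) = take (Suc (len (Suc k))) ?Z ! (?a + (h + 1))"
      by (rule nth_drop) (use lt a ls h pos in linarith)
    have 3: "take (Suc (len (Suc k))) ?Z ! x = Winf c x" if "x < len (Suc k)" for x
      using that by (simp add: nth_append W_nth)
    have 4: "i + (h + 1) < len (Suc k)" using ile h by linarith
    have 5: "?a + (h + 1) = len k + len (k - m) + h" using a by linarith
    have 6: "len k + len (k - m) + h < len (Suc k)" using h ls by linarith
    have "Winf c (i + (h + 1)) = Winf c (len k + len (k - m) + h)"
      using 1 unfolding 2 3[OF 4] unfolding 5 3[OF 6] .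
    then have "W c (Suc k) ! (i + (h + 1)) = Winf c h"
      unfolding Winf_step2[OF k h] W_nth[OF 4] .
    moreover have "i + 1 + h = i + (h + 1)" by simp
    ultimately show "W c (Suc k) ! (i + 1 + h) = Winf c h" by (simp only:)
  qed
  \<comment> \<open>\<open>i + 1\<close> is not 0: the extra letter on the left excludes the copy at
    the beginning.\<close>
  from occ_Suc_ends[OF k this] a show "?a \<le> i" by linarith
qed

text \<open>The marker is a power of \<open>\<not> c\<close> longer than any in
  \<open>W c n\<close>. All but its last letter belong to the first phase; the last one completes a
  new power and moves the centre of the palindromic suffix to the marker.\<close>

lemma rich_word_small_step:
  assumes n: "m \<le> n" "n \<le> 2 * m" and rich: "rich_word (W c n)"
  shows "rich_word (W c (Suc n))"
proof -
  let ?Q = "W (\<not> c) (n - m)"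
  let ?Z = "W c n @ ?Q @ W c n"
  define r where "r = len n + (n - m)"
  have lQ: "len (n - m) = Suc (n - m)" using n by (simp add: len_base)
  have Sr: "Suc r = len n + len (n - m)" by (simp add: r_def lQ)
  have lZ: "length ?Z = len n + len (n - m) + len n" by simp
  have rich_r: "rich_word (take r ?Z)"
  proof (cases "n = m")
    case True
    then show ?thesis using rich by (simp add: r_def)
  next
    case False
    then obtain k where k: "n = Suc k" "m \<le> k" using n by (cases n) auto
    have lk: "len (k - m) = n - m" using k n by (simp add: len_base Suc_diff_le)
    have pre: "prefix (W (\<not> c) (k - m)) ?Q" by (rule prefix_W) (simp add: k)
    then obtain y where y: "?Q = W (\<not> c) (k - m) @ y" by (auto simp: prefix_def)
    have "r = len n + len (k - m)" using lk by (simp add: r_def)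
    then have "take r ?Z = take r (W c n @ W (\<not> c) (k - m) @ W c k)"
      unfolding y by simp
    then show ?thesis
      using rich_word_first_phase[OF k(2), of c r] rich lk unfolding k(1)[symmetric] r_def by simp
  qed
  have uni: "len n \<le> i" if o: "occ ?Q (W c n @ ?Q) i" for i
  proof (rule ccontr)
    assume neg: "\<not> len n \<le> i"
    show False
    proof (cases "i + len (n - m) \<le> len n")
      case True
      then have "occ ?Q (W c n) i" using occ_drop_context[of ?Q "[]" "W c n" ?Q i] o by simp
      then show False using not_occ_opposite[of "\<not> c" "n - m" i] n by simp
    next
      case False
      define h where "h = len n - Suc i"
      have h: "h < len (n - m)" "i + h = len n - Suc 0" using False neg by (auto simp: h_def)
      have "(W c n @ ?Q) ! (i + h) = ?Q ! h" using o h(1) unfolding occ_def by simp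
      moreover have "(W c n @ ?Q) ! (i + h) = c" unfolding h(2) using W_last[of c n] by (simp add: nth_append)
      moreover have "?Q ! h = (\<not> c)" using h(1) n by (simp add: W_base lQ del: replicate.simps)
      ultimately show False by simp
    qed
  qed
  have "rich_word (take (length ?Z) ?Z)"
  proof (rule rich_word_closure_Suc[OF _ _ _ rich_r])
    have tk: "take (Suc r) ?Z = W c n @ ?Q" "length ?Z - Suc r = len n" by (simp_all add: Sr)
    show "rev ?Z = ?Z" by simp
    show "Suc r \<le> length ?Z" "r \<le> length ?Z" "length ?Z \<le> Suc (2 * r)"
      unfolding lZ using Sr len_pos[of "n - m"] by linarith+
    fix i assume "occ (drop (length ?Z - Suc r) (take (Suc r) ?Z)) (take (Suc r) ?Z) i"
    then show "length ?Z - Suc r \<le> i" using uni[of i] unfolding tk by simp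
  qed simp
  then show ?thesis using n by (simp add: W_step)
qed

text \<open>The marker \<open>?Q\<close> has \<open>W c j\<close> as its centre. The first phase
  lasts while \<open>?Q\<close> looks like \<open>W (\<not> c) (j + m)\<close> followed by the limit
  word of \<open>c\<close>; at the first disagreement the palindromic suffix jumps to the central
  \<open>W c j\<close>, and a second closure completes \<open>?Z\<close>.\<close>

lemma rich_word_big_step:
  assumes n: "n = Suc (j + 2 * m)" and rich: "rich_word (W c n)"
  shows "rich_word (W c (Suc n))"
proof -
  let ?Q = "W (\<not> c) (Suc (j + m))" and ?Q' = "W (\<not> c) (j + m)"
  let ?Z = "W c n @ ?Q @ W c n"
  have nm: "n - m = Suc (j + m)" "m \<le> n" "m \<le> j + m" using n by simp_all
  have stQ: "?Q = ?Q' @ W c j @ ?Q'" using W_step[OF nm(3), of "\<not> c"] by simp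
  have lQ: "len (Suc (j + m)) = 2 * len (j + m) + len j" using len_step[OF nm(3)] by simp
  obtain e where e: "mismatch j e" and e0: "j < m \<Longrightarrow> e = 0"
    using mismatch_exists mismatch_low by (cases "j < m") blast+
  have "len (Suc j - m) \<le> len (j + m)" using m_pos by simp
  then have elt: "e < len (j + m)" using e unfolding mismatch_def by linarith
  have ag: "Winf c (len j + y) = Winf (\<not> c) y" if "y < e" for y using e that unfolding mismatch_def by blast
  have dis: "Winf c (len j + e) \<noteq> Winf (\<not> c) e" using e unfolding mismatch_def by blast
  have dl: "len j + e < len (Suc j)" using e unfolding mismatch_def by blast
  have lmono: "len (Suc j) \<le> len n" "len (Suc j) \<le> len (j + 2 * m)" "len (j + m) \<le> len n" using n m_pos by simp_all
  \<comment> \<open>The disagreement comes \<open>len j + e\<close> letters after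
    \<open>?Q'\<close>. The new palindromic suffix is \<open>W c j\<close> with \<open>Suc e\<close>
    letters on either side and starts at \<open>a\<close>.\<close>
  define r where "r = len n + (len (j + m) + len j + e)"
  define a where "a = len n + len (j + m) - Suc e"
  have lZ: "length ?Z = len n + len (Suc (j + m)) + len n" by simp
  have aS: "a + Suc e = len n + len (j + m)" using elt by (simp add: a_def)
  have aZ: "length ?Z - Suc r = a" unfolding lZ lQ r_def a_def by simp
  have Sr: "Suc r \<le> len n + len (Suc (j + m))" unfolding r_def lQ using elt by simp
  have Qn1: "?Q ! k = Winf (\<not> c) k" if "k < len (Suc (j + m))" for k using that by (rule W_nth)
  have Qmid: "Winf (\<not> c) (len (j + m) + x) = Winf c x" if "x < len j" for x
    using Winf_step1[OF nm(3), of x "\<not> c"] that by simp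
  have Qend: "Winf (\<not> c) (len (j + m) + len j + y) = Winf (\<not> c) y" if "y < len (j + m)" for y
    using Winf_step2[OF nm(3) that, of "\<not> c"] by simp
  have rich_r: "rich_word (take r ?Z)"
  proof -
    let ?k = "j + 2 * m"
    let ?Z1 = "W c (Suc ?k) @ W (\<not> c) (?k - m) @ W c ?k"
    have km: "?k - m = j + m" by simp
    have rr: "len (Suc ?k) \<le> r" "r \<le> len (Suc ?k) + len (?k - m) + len ?k"
      unfolding km r_def n[symmetric] using dl lmono by linarith+
    have "take r ?Z = take r ?Z1"
    proof (rule nth_equalityI)
      show "length (take r ?Z) = length (take r ?Z1)" using rr Sr n by simp
      fix x assume "x < length (take r ?Z)"
      then have x: "x < r" by simp
      have "?Z ! x = ?Z1 ! x"
      proof (cases "x < len n")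
        case True
        then show ?thesis by (simp add: nth_append n)
      next
        case False
        then obtain y where y: "x = len n + y" using le_Suc_ex[of "len n" x] by auto
        have yr: "y < len (j + m) + len j + e" using x y by (simp add: r_def)
        then have "y < len (Suc (j + m))" using Sr unfolding r_def by simp
        then have 1: "?Z ! x = Winf (\<not> c) y" by (simp add: y nth_append Qn1)
        have 2: "?Z1 ! x = (?Q' @ W c ?k) ! y" unfolding y km n[symmetric] by (simp add: nth_append)
        show ?thesis
        proof (cases "y < len (j + m)")
          case True
          then show ?thesis using 1 2 by (simp add: nth_append W_nth)
        next
          case False
          then obtain h where h: "y = len (j + m) + h" using le_Suc_ex[of "len (j + m)" y] by auto
          have hl: "h < len j + e" using yr h by simp
          then have "h < len ?k" using dl lmono by linarith
          then have 3: "?Z1 ! x = Winf c h" using 2 h by (simp add: nth_append W_nth)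
          show ?thesis
          proof (cases "h < len j")
            case True
            then show ?thesis using 1 3 Qmid h by simp
          next
            case False
            then obtain g where g: "h = len j + g" using le_Suc_ex[of "len j" h] by auto
            have "g < e" using hl g by simp
            then show ?thesis using 1 3 ag[of g] Qend[of g] elt h g by (simp add: add.assoc)
          qed
        qed
      qed
      then show "take r ?Z ! x = take r ?Z1 ! x" by (simp only: nth_take[OF x])
    qed
    then show ?thesis using rich_word_first_phase[of ?k c r] rich rr n by simp
  qed
  define X where "X = take (Suc r) ?Z"
  define s where "s = drop a X"
  have lX: "length X = Suc r" using Sr by (simp add: X_def)
  have ls: "length s = len j + 2 * Suc e"
  proof -
    have "Suc r = a + (len j + 2 * Suc e)" using aS by (simp add: r_def)
    then show ?thesis unfolding s_def length_drop lX by linarith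
  qed
  have X1: "X ! k = W c n ! k" if "k < len n" for k
  proof -
    have "k < Suc r" using that unfolding r_def by linarith
    then show ?thesis unfolding X_def nth_take[OF \<open>k < Suc r\<close>] using that by (simp add: nth_append)
  qed
  have X2: "X ! (len n + k) = ?Q ! k" if "len n + k < Suc r" for k
  proof -
    have "k < len (Suc (j + m))" using that Sr by linarith
    then show ?thesis unfolding X_def nth_take[OF that] by (simp add: nth_append)
  qed
  have s_nth: "s ! k = X ! (a + k)" if "k < len j + 2 * Suc e" for k
  proof -
    have "a \<le> length X" using aS unfolding lX r_def by linarith
    then show ?thesis unfolding s_def by (rule nth_drop)
  qed
  have s_mid: "s ! (Suc e + k) = Winf c k" if "k < len j" for k
  proof -
    have ix: "a + (Suc e + k) = len n + (len (j + m) + k)" using aS by linarith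
    have lt: "Suc e + k < len j + 2 * Suc e" using that by simp
    have "s ! (Suc e + k) = X ! (len n + (len (j + m) + k))"
      by (simp only: s_nth[OF lt] ix)
    also have "\<dots> = ?Q ! (len (j + m) + k)" by (rule X2) (use that in \<open>simp add: r_def\<close>)
    also have "\<dots> = Winf c k" using that lQ Qn1 Qmid by simp
    finally show ?thesis .
  qed
  have s_last: "s ! (Suc e + (len j + e)) = Winf (\<not> c) e"
  proof -
    have ix: "a + (Suc e + (len j + e)) = len n + (len (j + m) + len j + e)" using aS by linarith
    have lt: "Suc e + (len j + e) < len j + 2 * Suc e" by simp
    have "s ! (Suc e + (len j + e)) = X ! (len n + (len (j + m) + len j + e))"
      by (simp only: s_nth[OF lt] ix)
    also have "\<dots> = ?Q ! (len (j + m) + len j + e)" by (rule X2) (simp add: r_def)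
    also have "\<dots> = Winf (\<not> c) e" using lQ elt Qn1 Qend[OF elt] by simp
    finally show ?thesis .
  qed
  have s_pal: "rev s = s"
    using rev_centre[of ?Z "Suc r"] Sr unfolding aZ s_def X_def by simp
  have s_first: "s ! 0 = Winf (\<not> c) e"
  proof -
    have "rev s ! 0 = s ! (length s - Suc 0)" by (rule rev_nth) (simp add: ls)
    moreover have "length s - Suc 0 = Suc e + (len j + e)" unfolding ls by simp
    ultimately show ?thesis using s_last s_pal by simp
  qed
  have uni: "a \<le> i" if o: "occ s X i" for i
  proof -
    have ile: "i + (len j + 2 * Suc e) \<le> Suc r" using o unfolding occ_def ls lX by blast
    have o_nth: "X ! (i + k) = s ! k" if "k < len j + 2 * Suc e" for k
      using o that unfolding occ_def ls by blast
    let ?Y = "W c n @ ?Q"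
    have X: "X = take (Suc r) ?Y" using Sr by (simp add: X_def)
    have XY: "X ! k = ?Y ! k" if "k < Suc r" for k unfolding X by (rule nth_take[OF that])
    have oW: "occ (W c j) ?Y (i + Suc e)"
      unfolding occ_W
    proof (intro conjI allI impI)
      show "i + Suc e + len j \<le> length ?Y" using ile Sr by simp
      fix k assume k: "k < len j"
      have "?Y ! (i + (Suc e + k)) = X ! (i + (Suc e + k))" using XY k ile by simp
      also have "\<dots> = s ! (Suc e + k)" by (rule o_nth) (use k in simp)
      finally show "?Y ! (i + Suc e + k) = Winf c k" using s_mid[OF k] by (simp add: add.assoc)
    qed
    have in_Q: "a \<le> i" if "len n \<le> i + Suc e" "occ (W c j) ?Q (i + Suc e - len n)"
      using occ_centre[OF that(2)] aS that(1) by linarith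
    show ?thesis
    proof (cases "m \<le> j")
      case True
      have "suffix (W c j) (W c n)" "prefix (W (\<not> c) (j - m)) ?Q"
        using n by (simp_all add: suffix_W prefix_W)
      from no_straddle[OF True oW this]
      consider "occ (W c j) (W c n) (i + Suc e)"
        | "len n \<le> i + Suc e" "occ (W c j) ?Q (i + Suc e - len n)" by auto
      then show ?thesis
      proof cases
        case 1
        \<comment> \<open>As a half of \<open>W c (Suc j)\<close> the copy has the wrong letter at
          offset \<open>e\<close> on one side; as a centre it needs
          \<open>W (\<not> c) (Suc (j + m))\<close> inside \<open>W c n\<close>, whose rank is just
          too small.\<close>
        from occ_placed[OF True 1] n have "placed c j (W c n) (i + Suc e)" by auto
        then consider "occ (W c (Suc j)) (W c n) (i + Suc e)"
          | q where "q + (len j + len (j - m)) = i + Suc e" "occ (W c (Suc j)) (W c n) q"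
          | q where "occ (W (\<not> c) (Suc (j + m))) (W c n) q"
          unfolding placed_def by blast
        then have False
        proof cases
          case 1
          then have "W c n ! (i + Suc e + (len j + e)) = Winf c (len j + e)" "i + Suc e + (len j + e) < len n"
            using dl by (auto simp: occ_W)
          then have "X ! (i + (Suc e + (len j + e))) = Winf c (len j + e)"
            using X1[of "i + Suc e + (len j + e)"] by (simp add: add.assoc)
          then show False using o_nth[of "Suc e + (len j + e)"] s_last dis by simp
        next
          case 2
          have k: "len (Suc j) - Suc (len j + e) < len (Suc j)" using dl by linarith
          have "len (Suc j) = 2 * len j + len (j - m)" by (rule len_step[OF True])
          then have qi: "q + (len (Suc j) - Suc (len j + e)) = i" using 2(1) dl by linarith
          have "W c n ! (q + (len (Suc j) - Suc (len j + e))) = W c (Suc j) ! (len (Suc j) - Suc (len j + e))"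
            using 2(2) k unfolding occ_def length_W by blast
          then have "W c n ! i = Winf c (len j + e)" unfolding qi W_nth_rev[OF dl] .
          moreover have "q + len (Suc j) \<le> len n" using 2(2) unfolding occ_W by simp
          then have "i < len n" using k qi by linarith
          ultimately show False using X1[of i] o_nth[of 0] s_first dis by simp
        next
          case 3
          then show False using not_occ_opposite[of "\<not> c" "Suc (j + m)" q] n by (simp add: mult_2 add.assoc)
        qed
        then show ?thesis ..
      qed (rule in_Q)
    next
      case False
      then have jm: "j < m" and e: "e = 0" using e0 by simp_all
      let ?t = "[\<not> c] @ W c j @ [\<not> c]"
      have lj: "len j = Suc j" using jm by (simp add: len_base)
      have ot: "occ ?t ?Y i"
        unfolding occ_def
      proof (intro conjI allI impI)
        show "i + length ?t \<le> length ?Y" using ile Sr e by simp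
        fix k assume "k < length ?t"
        then have k: "k < len j + 2 * Suc e" by (simp add: e)
        have "?Y ! (i + k) = s ! k" using XY[of "i + k"] o_nth[OF k] ile k by simp
        also have "\<dots> = ?t ! k"
        proof -
          consider "k = 0" | h where "k = Suc h" "h < len j" | "k = Suc (len j)"
            using k e by (cases k) (auto simp: less_Suc_eq)
          then show ?thesis
          proof cases
            case 1
            then show ?thesis using s_first e by simp
          next
            case 2
            then show ?thesis using s_mid[of h] e by (simp add: nth_append W_nth)
          next
            case 3
            then show ?thesis using s_last e by (simp add: nth_append)
          qed
        qed
        finally show "?Y ! (i + k) = ?t ! k" .
      qed
      have "suffix (W c m) (W c n)" "prefix [\<not> c] ?Q"
        using suffix_W[of m n c] prefix_W[of 0 "Suc (j + m)" "\<not> c"] nm by (simp_all add: W_base)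
      from isolated_run_no_straddle[OF jm ot this]
      consider "i + j + 3 \<le> len n" | "len n \<le> i" by auto
      then show ?thesis
      proof cases
        case 1
        then have "occ ?t (W c n) i"
          using occ_drop_context[of ?t "[]" "W c n" ?Q i] ot by (simp add: lj)
        then show ?thesis using isolated_run_absent[OF jm, of n c i] n by simp
      next
        case 2
        then have "occ (W c j) ?Q (i + Suc e - len n)"
          using occ_drop_context[of "W c j" "W c n" ?Q "[]" "i + Suc e"] oW by (simp add: occ_def)
        then show ?thesis using in_Q 2 by simp
      qed
    qed
  qed
  have "rich_word (take (length ?Z) ?Z)"
  proof (rule rich_word_closure_Suc[OF _ _ _ rich_r])
    show "rev ?Z = ?Z" by simp
    show "Suc r \<le> length ?Z" using Sr by simp
    show "length ?Z \<le> Suc (2 * r)" unfolding lZ lQ r_def by simp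
    show "r \<le> length ?Z" using Sr by simp
    show "length ?Z - Suc r \<le> i" 
      if "occ (drop (length ?Z - Suc r) (take (Suc r) ?Z)) (take (Suc r) ?Z) i" for i
      using uni that unfolding aZ s_def X_def by blast
  qed simp
  then show ?thesis using W_step[OF nm(2), of c] nm(1) by simp
qed

lemma rich_word_W: "rich_word (W c n)"
proof (induction n)
  case 0
  show ?case using rich_word_replicate[of "Suc 0" c] by (simp add: W_base)
next
  case (Suc n)
  consider "n < m" | "m \<le> n" "n \<le> 2 * m" | "2 * m < n" by linarith
  then show ?case
  proof cases
    case 1
    then show ?thesis using rich_word_replicate[of "Suc (Suc n)" c] by (simp add: W_base del: replicate.simps)
  next
    case 2
    then show ?thesis using rich_word_small_step Suc by blast
  next
    case 3
    then obtain j where "n = Suc (j + 2 * m)" by (metis add.commute add_Suc_right less_imp_Suc_add)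
    then show ?thesis using rich_word_big_step Suc by blast
  qed
qed

section \<open>The limit sequence\<close>

definition marker_seq :: "'a \<Rightarrow> 'a \<Rightarrow> nat \<Rightarrow> 'a" where
  "marker_seq a b k = (if Winf True k then a else b)"

lemma marker_seq_prefix: "segment (marker_seq a b) 0 (len N) = map (\<lambda>v. if v then a else b) (W True N)"
  by (rule nth_equalityI) (simp_all add: marker_seq_def W_nth)

lemma range_marker_seq: "range (marker_seq a b) \<subseteq> {a, b}"
  by (auto simp: marker_seq_def)

lemma rich_marker_seq:
  assumes "a \<noteq> b"
  shows "rich (marker_seq a b)"
  unfolding rich_def
proof (intro allI impI)
  fix w assume "factor_of w (marker_seq a b)"
  then obtain i where i: "w = segment (marker_seq a b) i (i + length w)" by (rule factor_of_segmentE)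
  let ?N = "i + length w"
  have "sublist w (segment (marker_seq a b) 0 (len ?N))"
    using sublist_segment[of 0 i ?N "len ?N" "marker_seq a b"] i len_gt[of ?N] by simp
  moreover have "rich_word (segment (marker_seq a b) 0 (len ?N))"
    unfolding marker_seq_prefix using assms by (intro rich_word_map rich_word_W injI) (auto split: if_splits)
  ultimately show "rich_word w" by (rule rich_word_sublist[rotated])
qed

lemma recurrent_marker_seq: "recurrent (marker_seq a b)"
  unfolding recurrent_def
proof (intro allI impI)
  fix w assume "factor_of w (marker_seq a b)"
  then obtain i where i: "map (marker_seq a b) [i..<i + length w] = w"
    unfolding factor_of_def occurs_at_def by blast
  show "infinite {i. occurs_at w (marker_seq a b) i}"
    unfolding infinite_nat_iff_unbounded_le
  proof
    fix B
    \<comment> \<open>The prefix of length \<open>len N\<close> contains the given occurrence and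
      returns after its marker, beyond \<open>B\<close>.\<close>
    define N where "N = B + m + i + length w"
    have N: "m \<le> N" "i + length w < len N" "B < len N" using len_gt[of N] by (simp_all add: N_def)
    have "occurs_at w (marker_seq a b) (len N + len (N - m) + i)"
      unfolding occurs_at_def
    proof (rule nth_equalityI)
      fix k assume "k < length (map (marker_seq a b) [len N + len (N - m) + i..<len N + len (N - m) + i + length w])"
      then have k: "k < length w" by simp
      have "Winf True (len N + len (N - m) + (i + k)) = Winf True (i + k)"
        by (rule Winf_step2[OF N(1)]) (use N(2) k in linarith)
      moreover have "w ! k = marker_seq a b (i + k)" using k arg_cong[OF i, of "\<lambda>x. x ! k"] by simp
      ultimately show "map (marker_seq a b) [len N + len (N - m) + i..<len N + len (N - m) + i + length w] ! k = w ! k"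
        using k by (simp add: marker_seq_def add.assoc)
    qed simp
    then show "\<exists>n\<ge>B. n \<in> {i. occurs_at w (marker_seq a b) i}"
      using N(3) by (intro exI[of _ "len N + len (N - m) + i"]) simp
  qed
qed

text \<open>Agreements shorter than \<open>3 * len m\<close> escape the run bound, but this
  threshold does not depend on \<open>p\<close>, so it matters only for short periods.\<close>

lemma marker_seq_exponents:
  assumes ab: "a \<noteq> b" and e: "e \<in> exponents (marker_seq a b) n"
  obtains p L where "1 \<le> p" "n \<le> p" "real_of_rat e = real L / real p"
    "L < p + 3 * len m \<or> Suc m * (L - p) \<le> (m + 10) * p"
proof -
  obtain p L i where p: "1 \<le> p" "n \<le> p" "e = of_nat L / of_nat p"
    and per: "\<And>k. k + p < L \<Longrightarrow> marker_seq a b (i + k) = marker_seq a b (i + k + p)"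
    using exponentsE[OF e] by blast
  have "Suc m * (L - p) \<le> (m + 10) * p" if long: "\<not> L < p + 3 * len m"
  proof -
    have pL: "p \<le> L" using long by linarith
    define N where "N = i + L"
    have N: "i + L < len N" unfolding N_def by (rule len_gt)
    have "is_run (W True N) p i (i + L - p)"
      unfolding is_run_def
    proof (intro conjI allI impI)
      show "i \<le> i + L - p" "i + L - p + p \<le> length (W True N)" using pL N by simp_all
      fix k assume k: "i \<le> k \<and> k < i + L - p"
      define h where "h = k - i"
      have h: "k = i + h" "h + p < L" using k pL unfolding h_def by linarith+
      then have "marker_seq a b k = marker_seq a b (k + p)" using per by simp
      then have "Winf True k = Winf True (k + p)" using ab by (auto simp: marker_seq_def split: if_splits)
      moreover have "k < len N" "k + p < len N" using h N by linarith+
      ultimately show "W True N ! k = W True N ! (k + p)" by (simp add: W_nth)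
    qed
    moreover have "3 * len m \<le> i + L - p - i" using long by linarith
    ultimately have "Suc m * (i + L - p - i) \<le> (m + 10) * p" using p(1) by (intro run_bound) simp_all
    moreover have "i + L - p - i = L - p" by linarith
    ultimately show ?thesis by simp
  qed
  moreover have "real_of_rat e = real L / real p" using p by (simp add: of_rat_divide)
  ultimately show thesis using that p by blast
qed

lemma marker_seq_asymptotic:
  assumes ab: "a \<noteq> b"
  shows "asymptotic_critical_exponent (marker_seq a b) \<le> ereal (2 + 9 / real (Suc m))"
proof -
  have periodic: "real L / real p \<le> 2 + 9 / real (Suc m)"
    if "1 \<le> p" "Suc m * (L - p) \<le> (m + 10) * p" for L p
  proof -
    have "real (Suc m) * (real L - real p) \<le> real (Suc m) * real (L - p)"
      by (intro mult_left_mono) linarith+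
    also have "\<dots> = real (Suc m * (L - p))" by (simp only: of_nat_mult)
    also have "\<dots> \<le> real ((m + 10) * p)" using that(2) by (simp only: of_nat_le_iff)
    finally have "real (Suc m) * real L \<le> (2 * real (Suc m) + 9) * real p" by (simp add: algebra_simps)
    then have "real L \<le> (2 * real (Suc m) + 9) * real p / real (Suc m)"
      by (simp add: pos_le_divide_eq mult.commute)
    also have "\<dots> = (2 + 9 / real (Suc m)) * real p" by (simp add: field_simps)
    finally show ?thesis using that(1) by (simp add: pos_divide_le_eq)
  qed
  \<comment> \<open>Finiteness has to come first, since otherwise the asymptotic exponent is
    infinite by definition. The summand 11 is \<open>2 + 9\<close>.\<close>
  have "critical_exponent (marker_seq a b) \<le> ereal (11 + 3 * real (len m))"
    unfolding critical_exponent_def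
  proof (rule SUP_least)
    fix e assume "e \<in> exponents (marker_seq a b) 0"
    then obtain p L where p: "1 \<le> p" "real_of_rat e = real L / real p"
      "L < p + 3 * len m \<or> Suc m * (L - p) \<le> (m + 10) * p"
      by (rule marker_seq_exponents[OF ab])
    have "real L / real p \<le> 11 + 3 * real (len m)"
      using p(3)
    proof
      assume "L < p + 3 * len m"
      moreover have "3 * len m * 1 \<le> 3 * len m * p" using p(1) by (rule mult_le_mono2)
      moreover have "(11 + 3 * len m) * p = 11 * p + 3 * len m * p" by (rule distrib_right)
      ultimately have "L \<le> (11 + 3 * len m) * p" by linarith
      then have "real L \<le> real ((11 + 3 * len m) * p)" by (simp only: of_nat_le_iff)
      then show ?thesis using p(1) by (simp add: pos_divide_le_eq)
    next
      assume "Suc m * (L - p) \<le> (m + 10) * p"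
      from periodic[OF p(1) this] have "real L / real p \<le> 2 + 9 / real (Suc m)" .
      also have "9 / real (Suc m) \<le> 9" by (simp add: field_simps)
      finally show ?thesis by simp
    qed
    then show "ereal (real_of_rat e) \<le> ereal (11 + 3 * real (len m))" using p(2) by simp
  qed
  then have "critical_exponent (marker_seq a b) \<noteq> \<infinity>" by auto
  then have "asymptotic_critical_exponent (marker_seq a b) = (INF n. exponent_sup (marker_seq a b) n)"
    by (simp add: asymptotic_critical_exponent_def lim_exponent_sup)
  \<comment> \<open>From period \<open>3 * len m\<close> on, the short alternative of
    \<open>marker_seq_exponents\<close> gives exponents below 2.\<close>
  also have "\<dots> \<le> exponent_sup (marker_seq a b) (3 * len m)" by (rule INF_lower) simp
  also have "\<dots> \<le> ereal (2 + 9 / real (Suc m))"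
  proof (rule SUP_least)
    fix e assume "e \<in> exponents (marker_seq a b) (3 * len m)"
    then obtain p L where p: "1 \<le> p" "3 * len m \<le> p" "real_of_rat e = real L / real p"
      "L < p + 3 * len m \<or> Suc m * (L - p) \<le> (m + 10) * p"
      by (rule marker_seq_exponents[OF ab])
    have "real L / real p \<le> 2 + 9 / real (Suc m)"
      using p(4)
    proof
      assume "L < p + 3 * len m"
      then have "real L \<le> 2 * real p" using p(2) by linarith
      then have "real L / real p \<le> 2" using p(1) by (simp add: pos_divide_le_eq)
      also have "2 \<le> 2 + 9 / real (Suc m)" by simp
      finally show ?thesis .
    qed (rule periodic[OF p(1)])
    then show "ereal (real_of_rat e) \<le> ereal (2 + 9 / real (Suc m))" using p(3) by simp
  qed
  finally show ?thesis .
qed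

end

section \<open>The threshold from both bounds\<close>

theorem theorem1:
  fixes A :: "'a set" and d :: nat
  assumes "d \<ge> 2" and "card A = d"
  shows "asymptotic_repetition_threshold (recurrent_rich_sequences A) = 2"
proof (rule antisym)
  have finA: "finite A" using assms card.infinite by fastforce
  obtain a b where ab: "a \<in> A" "b \<in> A" "a \<noteq> b"
    using assms by (metis card_le_Suc0_iff_eq finA not_less_eq_eq numeral_2_eq_2)
  show "2 \<le> asymptotic_repetition_threshold (recurrent_rich_sequences A)"
    unfolding asymptotic_repetition_threshold_def recurrent_rich_sequences_def
    by (rule INF_greatest) (use rich_asymptotic_lower_bound finA in blast)
  show "asymptotic_repetition_threshold (recurrent_rich_sequences A) \<le> 2"
  proof (rule ereal_le_epsilon2)
    fix e :: real assume e: "0 < e"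
    obtain m where "9 / e < real m" using reals_Archimedean2 by blast
    then have "9 / e < real (Suc (Suc m))" by simp
    then have "9 < real (Suc (Suc m)) * e" unfolding pos_divide_less_eq[OF e] .
    then have small: "9 / real (Suc (Suc m)) < e"
      unfolding pos_divide_less_eq[OF of_nat_0_less_iff[THEN iffD2, OF zero_less_Suc]]
      by (simp only: mult.commute)
    \<comment> \<open>The successor secures \<open>m_pos\<close>; the excess over 2 is then at most
      \<open>9 / real (Suc (Suc m))\<close>.\<close>
    interpret marker_words "Suc m" by unfold_locales simp
    have "marker_seq a b \<in> recurrent_rich_sequences A"
      unfolding recurrent_rich_sequences_def mem_Collect_eq
    proof (intro conjI)
      show "range (marker_seq a b) \<subseteq> A" 
        by (rule subset_trans[OF range_marker_seq]) (use ab in simp)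
    qed (rule recurrent_marker_seq rich_marker_seq[OF ab(3)])+
    then have "asymptotic_repetition_threshold (recurrent_rich_sequences A)
      \<le> asymptotic_critical_exponent (marker_seq a b)"
      unfolding asymptotic_repetition_threshold_def by (rule INF_lower)
    also have "\<dots> \<le> ereal (2 + 9 / real (Suc (Suc m)))" by (rule marker_seq_asymptotic[OF ab(3)])
    also have "\<dots> \<le> ereal (2 + e)" using small by simp
    also have "\<dots> = 2 + ereal e" by simp
    finally show "asymptotic_repetition_threshold (recurrent_rich_sequences A) \<le> 2 + ereal e" .
  qed
qed

end
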